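(* Let $\gamma\colon [0,1] \to \mathbb{R}^2$ be a simple rectifiable loop. Then $\gamma$ inscribes a non-degenerate rectangle whose vertices cut $\gamma$ into four pieces $\gamma^{(1)}, \gamma^{(2)}, \gamma^{(3)}, \gamma^{(4)}$, in cyclic order along the loop, such that the total length of $\gamma^{(1)}$ and $\gamma^{(3)}$ is equal to the total length of $\gamma^{(2)}$ and $\gamma^{(4)}$.
   Context: A simple loop in $\mathbb{R}^2$ is a continuous map $\gamma\colon [0,1]\to\mathbb{R}^2$ with $\gamma(0)=\gamma(1)$ that is injective on $[0,1)$. A curve $\gamma\colon [0,1] \to \mathbb{R}^d$ is rectifiable if there is a constant $C>0$ such that $\sum_{j=1}^{n-1} |\gamma(x_{j+1}) - \gamma(x_j)| < C$ for any $n$ and any points $x_1 < x_2 < \dots < x_n$ in $[0,1]$; its length is then well-defined. A loop inscribes a polygon if all vertices of the polygon lie in the image $\gamma([0,1])$. The four vertices of an inscribed rectangle cut the closed curve $\gamma$ into four arcs, the pieces between consecutive vertices along the curve. *)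

theory Defs
  imports "HOL-Analysis.Analysis"
begin

text \<open>
  As for the paths of the library, only the values of a curve on \<open>{0..1}\<close> matter.
\<close>

definition inscribed_polygon_lengths :: "(real \<Rightarrow> 'a::real_normed_vector) \<Rightarrow> real set" where
  "inscribed_polygon_lengths g =
     {\<Sum>j = 1..<n. norm (g (x (Suc j)) - g (x j)) | (n::nat) (x::nat \<Rightarrow> real).
        (\<forall>j\<in>{1..n}. x j \<in> {0..1}) \<and> (\<forall>j\<in>{1..<n}. x j < x (Suc j))}"

definition rectifiable :: "(real \<Rightarrow> 'a::real_normed_vector) \<Rightarrow> bool" where
  "rectifiable g \<longleftrightarrow> (\<exists>C>0. \<forall>s\<in>inscribed_polygon_lengths g. s < C)"

text \<open>
  The set of inscribed polygon lengths always contains \<open>0\<close>, and it is bounded above exactly when the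
  curve is rectifiable; the value of \<open>curve_length\<close> is meaningful only in that case.
  Subpaths of a rectifiable curve, and concatenations of two of them, are again rectifiable.
\<close>

definition curve_length :: "(real \<Rightarrow> 'a::real_normed_vector) \<Rightarrow> real" where
  "curve_length g = Sup (inscribed_polygon_lengths g)"

text \<open>
  \<open>a\<close>, \<open>b\<close>, \<open>c\<close>, \<open>d\<close> are the vertices in their order around the rectangle: a parallelogram with
  a right angle at \<open>a\<close> and both side lengths positive.
\<close>

definition nondegenerate_rectangle :: "'a::real_inner \<Rightarrow> 'a \<Rightarrow> 'a \<Rightarrow> 'a \<Rightarrow> bool" where
  "nondegenerate_rectangle a b c d \<longleftrightarrow>
     b - a = c - d \<and> (b - a) \<bullet> (d - a) = 0 \<and> a \<noteq> b \<and> a \<noteq> d"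

end

theory Submission
  imports Defs
begin

text \<open>
  Parametrise the loop by arc length over a circle of length \<open>1\<close>. The required rectangles correspond to
  cyclically ordered points \<open>x\<^sub>1, x\<^sub>2, x\<^sub>3, x\<^sub>4\<close> of the circle whose first and third gaps add up to
  \<open>1/2\<close> and for which \<open>f = c x\<^sub>1 - c x\<^sub>2 + c x\<^sub>3 - c x\<^sub>4\<close> and \<open>h = \<bar>c x\<^sub>1 - c x\<^sub>3\<bar> - \<bar>c x\<^sub>2 - c x\<^sub>4\<bar>\<close>
  are both zero: a parallelogram with equal diagonals is a rectangle. The configurations form a solid
  torus, a circle times a square, on which the cyclic relabelling \<open>x\<^sub>1 \<mapsto> x\<^sub>2 \<mapsto> x\<^sub>3 \<mapsto> x\<^sub>4 \<mapsto> x\<^sub>1\<close> acts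
  as a shift along the circle by \<open>1/4\<close> together with a quarter turn of the square. Relabelling changes
  the signs of \<open>f\<close> and \<open>h\<close>. On the boundary of the solid torus \<open>f\<close> does not vanish, as the loop is simple.

  The plane-valued function \<open>f\<close> winds an odd number of times around \<open>0\<close> along the boundary of each square
  (\<open>boundary_winding_odd\<close>). So, generically, the number of zeros of \<open>f\<close> in a square is odd; these are the
  inscribed parallelograms. Suppose that \<open>h\<close> is not zero at any zero of \<open>f\<close>. Then the zeros of \<open>f\<close> fall
  into those with \<open>h > 0\<close> and those with \<open>h < 0\<close>, each kind contributes to the winding number an amount
  that is the same for all squares, and the relabelling exchanges the two kinds. Hence the winding number
  is even (\<open>boundary_winding_even\<close>), a contradiction. To separate the two contributions without a theory
  of degrees for continuous maps, \<open>(f, h)\<close> is normalised to a map into the unit sphere and lifted along the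
  Hopf map to a pair \<open>(z, w)\<close> of complex functions (\<open>continuous_hopf_lift\<close>). Then \<open>f\<close> is a positive
  multiple of \<open>z * cnj w\<close> away from its zeros, the zeros of \<open>w\<close> are the zeros of \<open>f\<close> with \<open>h > 0\<close>, and
  those of \<open>z\<close> are the zeros of \<open>f\<close> with \<open>h < 0\<close>. Both statements about winding numbers become statements
  about increments of continuous arguments.

  What remains is the arc length parametrisation itself: arc length is additive (\<open>arc_length_add\<close>) and, for
  a continuous rectifiable curve, continuous (\<open>continuous_on_arc_length\<close>).
\<close>

section \<open>Continuous arguments\<close>

lemma continuous_argument:
  fixes f :: "'a::real_normed_vector \<Rightarrow> complex"
  assumes "continuous_on S f" "contractible S" "\<And>x. x \<in> S \<Longrightarrow> f x \<noteq> 0"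
  obtains \<theta> where "continuous_on S \<theta>" "\<And>x. x \<in> S \<Longrightarrow> f x = cmod (f x) *\<^sub>R cis (\<theta> x)"
proof -
  obtain g where g: "continuous_on S g" "\<And>x. x \<in> S \<Longrightarrow> f x = exp (g x)"
    using continuous_logarithm_on_contractible[OF assms] by metis
  show ?thesis
  proof
    show "continuous_on S (\<lambda>x. Im (g x))"
      using g(1) by (intro continuous_intros)
    show "f x = cmod (f x) *\<^sub>R cis (Im (g x))" if "x \<in> S" for x
      by (simp add: g(2)[OF that] exp_eq_polar[of "g x"] scaleR_conv_of_real norm_mult)
  qed
qed

text \<open>
  Arguments are compared through equations between polar forms, in which only positive real factors
  are left undetermined.
\<close>

lemma cis_eq_if_scaleR_eq:
  assumes "r *\<^sub>R cis a = s *\<^sub>R cis b" "r > 0" "s > 0"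
  shows "cis a = cis b"
proof -
  have "r = s"
    using arg_cong[OF assms(1), of cmod] assms(2,3) by simp
  then show ?thesis
    using assms by simp
qed

text \<open>
  Winding numbers enter the proof only through this lemma: if two continuous arguments describe the
  same direction, then their difference is a continuous function with values in a discrete set.
\<close>

lemma cis_eq_continuous_difference:
  fixes \<theta> \<phi> :: "'a::topological_space \<Rightarrow> real"
  assumes "connected S" "continuous_on S \<theta>" "continuous_on S \<phi>"
    and eq: "\<And>x. x \<in> S \<Longrightarrow> cis (\<theta> x) = cis (\<phi> x)"
  obtains n :: int where "\<And>x. x \<in> S \<Longrightarrow> \<theta> x = \<phi> x + 2 * pi * n"
proof -
  define d where "d x = (\<theta> x - \<phi> x) / (2 * pi)" for x
  have int: "d x \<in> \<int>" if "x \<in> S" for x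
  proof -
    have "cis (\<theta> x - \<phi> x) = 1"
      using eq[OF that] by (simp add: cis_divide[symmetric])
    then have "cos (\<theta> x - \<phi> x) = 1"
      by (simp add: complex_eq_iff)
    then obtain n :: int where "\<theta> x - \<phi> x = n * (2 * pi)"
      by (auto simp: cos_one_2pi_int)
    then show ?thesis
      by (simp add: d_def)
  qed
  have "d constant_on S"
  proof (rule continuous_discrete_range_constant[OF assms(1)])
    show "continuous_on S d"
      unfolding d_def using assms(2,3) by (intro continuous_intros) auto
    fix x assume "x \<in> S"
    have "1 \<le> norm (d y - d x)" if "y \<in> S" "d y \<noteq> d x" for y
    proof -
      have "d y - d x \<in> \<int>"
        using int[OF \<open>x \<in> S\<close>] int[OF that(1)] by auto
      then show ?thesis
        using Ints_nonzero_abs_ge1[of "d y - d x"] that(2) by simp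
    qed
    then show "\<exists>e>0. \<forall>y. y \<in> S \<and> d y \<noteq> d x \<longrightarrow> e \<le> norm (d y - d x)"
      by (intro exI[of _ 1]) auto
  qed
  then obtain c where c: "\<And>x. x \<in> S \<Longrightarrow> d x = c"
    by (auto simp: constant_on_def)
  show ?thesis
  proof (cases "S = {}")
    case False
    then obtain n :: int where "c = n"
      using int c by (metis Ints_cases ex_in_conv)
    then have "\<theta> x = \<phi> x + 2 * pi * n" if "x \<in> S" for x
      using c[OF that] by (simp add: d_def field_simps)
    then show ?thesis
      by (rule that)
  qed (use that in auto)
qed

section \<open>Lifting along the Hopf map\<close>

text \<open>
  For \<open>\<bar>f\<bar>\<^sup>2 + h\<^sup>2 = 1\<close> the Hermitian matrix with rows \<open>(h, f)\<close> and \<open>(cnj f, -h)\<close> has eigenvalues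
  \<open>1\<close> and \<open>-1\<close>, and \<open>(z, w)\<close> is an eigenvector for \<open>1\<close>. Sending the complex line of \<open>(z, w)\<close> to
  \<open>(f, h)\<close> is the Hopf map onto the unit sphere. The line of the antipode is the orthogonal complement.
\<close>

definition hopf_lift :: "complex \<Rightarrow> real \<Rightarrow> complex \<Rightarrow> complex \<Rightarrow> bool" where
  "hopf_lift f h z w \<longleftrightarrow>
     (z, w) \<noteq> (0, 0) \<and> f * w = of_real (1 - h) * z \<and> cnj f * z = of_real (1 + h) * w"

lemma hopf_lift_exists:
  assumes "(cmod f)\<^sup>2 + h\<^sup>2 = 1"
  shows "\<exists>z w. hopf_lift f h z w"
proof (cases "h = -1")
  case True
  then have "f = 0" using assms by simp
  then have "hopf_lift f h 0 1"
    using True by (simp add: hopf_lift_def)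
  then show ?thesis by blast
next
  case False
  have "f * cnj f = of_real (1 - h) * of_real (1 + h)"
    using assms unfolding complex_norm_square[symmetric] of_real_mult[symmetric] of_real_eq_iff
    by (simp add: algebra_simps power2_eq_square)
  moreover have "complex_of_real (1 + h) \<noteq> 0"
    using False unfolding of_real_eq_0_iff by linarith
  ultimately have "hopf_lift f h (of_real (1 + h)) (cnj f)"
    by (simp add: hopf_lift_def mult.commute)
  then show ?thesis by blast
qed

text \<open>
  The new vector is, up to a factor, the orthogonal projection of \<open>(z, w)\<close> onto the line over
  \<open>(f', h')\<close>. It vanishes only if \<open>(z, w)\<close> lies in the line over the antipode of \<open>(f', h')\<close>, but
  points of the sphere at distance less than \<open>2\<close> are not antipodal.
\<close>

lemma hopf_lift_step:
  assumes lift: "hopf_lift f h z w"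
    and unit: "(cmod f')\<^sup>2 + h'\<^sup>2 = 1"
    and close: "(cmod (f - f'))\<^sup>2 + (h - h')\<^sup>2 < 4"
  shows "hopf_lift f' h' (of_real (1 + h') * z + f' * w) (cnj f' * z + of_real (1 - h') * w)"
proof -
  define H :: complex where "H = of_real h"
  define H' :: complex where "H' = of_real h'"
  have sq: "f' * cnj f' = (1 - H') * (1 + H')"
  proof -
    have "f' * cnj f' = of_real ((1 - h') * (1 + h'))"
      unfolding complex_norm_square[symmetric] of_real_eq_iff
      using unit by (simp add: algebra_simps power2_eq_square)
    then show ?thesis by (simp add: H'_def)
  qed
  have e: "f * w = (1 - H) * z" "cnj f * z = (1 + H) * w" "z \<noteq> 0 \<or> w \<noteq> 0"
    using lift by (auto simp: hopf_lift_def H_def)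
  have "False" if z': "(1 + H') * z + f' * w = 0" and w': "cnj f' * z + (1 - H') * w = 0"
  proof -
    \<comment> \<open>The vector \<open>(z, w)\<close> would lie in the lines over \<open>(f, h)\<close> and over the antipode of
      \<open>(f', h')\<close>. This forces the squared distance of \<open>(f, h)\<close> and \<open>(f', h')\<close> to be \<open>4\<close>.\<close>
    let ?d = "f - f'" and ?e = "H - H'"
    have 1: "?d * w = (2 - ?e) * z"
      using e(1) z' by algebra
    have 2: "cnj ?d * z = (2 + ?e) * w"
      unfolding complex_cnj_diff using e(2) w' by algebra
    have "?d * cnj ?d * z = (2 - ?e) * (2 + ?e) * z"
      using 1 2 by algebra
    moreover have "?d * cnj ?d * w = (2 - ?e) * (2 + ?e) * w"
      using 1 2 by algebra
    ultimately have "?d * cnj ?d = (2 - ?e) * (2 + ?e)"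
      using e(3) by auto
    also have "\<dots> = of_real ((2 - (h - h')) * (2 + (h - h')))"
      by (simp add: H_def H'_def)
    finally have "(cmod ?d)\<^sup>2 = (2 - (h - h')) * (2 + (h - h'))"
      unfolding complex_norm_square[symmetric] of_real_eq_iff .
    then show False
      using close by (simp add: algebra_simps power2_eq_square)
  qed
  moreover have "f' * (cnj f' * z + (1 - H') * w) = (1 - H') * ((1 + H') * z + f' * w)"
    using sq by algebra
  moreover have "cnj f' * ((1 + H') * z + f' * w) = (1 + H') * (cnj f' * z + (1 - H') * w)"
    using sq by algebra
  ultimately show ?thesis
    unfolding hopf_lift_def by (auto simp: H'_def)
qed

text \<open>
  Contracting \<open>S\<close> to the origin deforms the map into a constant one. The contraction is cut into \<open>N\<close>
  steps so short that no point moves to its antipode, and the lift of the constant map is carried along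
  by projecting onto the new line at each step.
\<close>

lemma continuous_hopf_lift:
  fixes f :: "'a::real_normed_vector \<Rightarrow> complex" and h :: "'a \<Rightarrow> real"
  assumes S: "compact S" "convex S" "0 \<in> S"
    and f: "continuous_on S f" and h: "continuous_on S h"
    and unit: "\<And>x. x \<in> S \<Longrightarrow> (cmod (f x))\<^sup>2 + (h x)\<^sup>2 = 1"
  obtains z w where "continuous_on S z" "continuous_on S w"
    "\<And>x. x \<in> S \<Longrightarrow> hopf_lift (f x) (h x) (z x) (w x)"
proof -
  have uc: "uniformly_continuous_on S (\<lambda>x. (f x, h x))"
    using S(1) f h by (intro compact_uniformly_continuous continuous_intros)
  then obtain \<delta> where \<delta>: "\<delta> > 0"
    "\<And>x y. x \<in> S \<Longrightarrow> y \<in> S \<Longrightarrow> dist y x < \<delta> \<Longrightarrow> dist (f y, h y) (f x, h x) < 2"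
    unfolding uniformly_continuous_on_def by (metis zero_less_numeral)
  obtain B where B: "B > 0" "\<And>x. x \<in> S \<Longrightarrow> norm x \<le> B"
    using compact_imp_bounded[OF S(1)] bounded_pos by metis
  obtain N :: nat where N: "B / \<delta> < N"
    using reals_Archimedean2 by blast
  have "N > 0"
    using N B(1) \<delta>(1) by (metis divide_pos_pos gr0I less_asym of_nat_0)
  have shrink: "(k / N) *\<^sub>R x \<in> S" if "x \<in> S" "k \<le> N" for x and k :: nat
    using convexD_alt[OF S(2,3) that(1), of "k / N"] that(2) \<open>N > 0\<close> by simp
  have "\<exists>z w. continuous_on S z \<and> continuous_on S w \<and>
      (\<forall>x\<in>S. hopf_lift (f ((k / N) *\<^sub>R x)) (h ((k / N) *\<^sub>R x)) (z x) (w x))" if "k \<le> N" for k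
    using that
  proof (induction k)
    case 0
    obtain z w where "hopf_lift (f 0) (h 0) z w"
      using hopf_lift_exists[OF unit[OF S(3)]] by blast
    then show ?case
      by (intro exI[of _ "\<lambda>_. z"] exI[of _ "\<lambda>_. w"]) auto
  next
    case (Suc k)
    then obtain z w where zw: "continuous_on S z" "continuous_on S w"
      "\<And>x. x \<in> S \<Longrightarrow> hopf_lift (f ((k / N) *\<^sub>R x)) (h ((k / N) *\<^sub>R x)) (z x) (w x)"
      by auto
    define f' where "f' x = f ((Suc k / N) *\<^sub>R x)" for x
    define h' where "h' x = h ((Suc k / N) *\<^sub>R x)" for x
    have f': "continuous_on S f'" and h': "continuous_on S h'"
      unfolding f'_def h'_def
      by (auto intro!: continuous_on_compose2[OF f] continuous_on_compose2[OF h] continuous_intros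
          shrink Suc.prems simp del: of_nat_Suc)
    have "hopf_lift (f' x) (h' x) (of_real (1 + h' x) * z x + f' x * w x)
        (cnj (f' x) * z x + of_real (1 - h' x) * w x)" if x: "x \<in> S" for x
    proof (rule hopf_lift_step[OF zw(3)[OF x]])
      let ?a = "(k / N) *\<^sub>R x" and ?b = "(Suc k / N) *\<^sub>R x"
      have S': "?a \<in> S" "?b \<in> S"
        using shrink[OF x] Suc.prems by (auto simp del: of_nat_Suc)
      have "?b - ?a = (1 / N) *\<^sub>R x"
        by (simp add: scaleR_diff_left[symmetric] diff_divide_distrib[symmetric])
      then have "dist ?b ?a = norm x / N"
        by (simp add: dist_norm)
      also have "\<dots> \<le> B / N"
        using B(2)[OF x] by (simp add: divide_right_mono)
      also have "\<dots> < \<delta>"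
        using N \<open>N > 0\<close> \<delta>(1) by (simp add: field_simps)
      finally have "dist (f ?a, h ?a) (f ?b, h ?b) < 2"
        using \<delta>(2)[of ?b ?a] S' by (simp add: dist_commute)
      then have "sqrt ((cmod (f ?a - f ?b))\<^sup>2 + (h ?a - h ?b)\<^sup>2) < sqrt 4"
        by (simp add: dist_prod_def dist_norm)
      then show "(cmod (f ?a - f' x))\<^sup>2 + (h ?a - h' x)\<^sup>2 < 4"
        unfolding f'_def h'_def by (simp only: real_sqrt_less_iff)
      show "(cmod (f' x))\<^sup>2 + (h' x)\<^sup>2 = 1"
        unfolding f'_def h'_def by (rule unit[OF S'(2)])
    qed
    moreover have "continuous_on S (\<lambda>x. of_real (1 + h' x) * z x + f' x * w x)"
      "continuous_on S (\<lambda>x. cnj (f' x) * z x + of_real (1 - h' x) * w x)"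
      using f' h' zw(1,2) by (auto intro!: continuous_intros)
    ultimately show ?case
      unfolding f'_def h'_def by blast
  qed
  from this[of N] \<open>N > 0\<close> show ?thesis
    using that by auto
qed

text \<open>
  Eigenvectors of a Hermitian matrix for different eigenvalues are orthogonal.
\<close>

lemma hopf_lift_antipodal_orthogonal:
  assumes "hopf_lift f h z w" "hopf_lift (- f) (- h) z' w'"
  shows "z' * cnj z + w' * cnj w = 0"
proof -
  have 1: "- f * w' = of_real (1 - - h) * z'" "- cnj f * z' = of_real (1 + - h) * w'"
    using assms(2) unfolding hopf_lift_def complex_cnj_minus by blast+
  have "cnj (f * w) = cnj (of_real (1 - h) * z)" "cnj (cnj f * z) = cnj (of_real (1 + h) * w)"
    using assms(1) by (auto simp: hopf_lift_def)
  then have 2: "cnj f * cnj w = of_real (1 - h) * cnj z" "f * cnj z = of_real (1 + h) * cnj w"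
    by simp_all
  have "2 * (z' * cnj z + w' * cnj w) = 0"
    using 1 2 unfolding of_real_add of_real_diff of_real_minus of_real_1 by algebra
  then show ?thesis unfolding mult_eq_0_iff by simp
qed

section \<open>Zeros of equivariant maps on a solid cylinder\<close>

text \<open>
  The universal cover of the boundary of the solid cylinder, by the real plane. The number of times
  that a nonvanishing function winds around \<open>0\<close> along a boundary circle is then the increment of its
  continuous argument under \<open>t \<mapsto> t + 1\<close>.
\<close>

definition cylinder :: "real \<times> real \<Rightarrow> real \<times> complex" where
  "cylinder x = (fst x, cis (2 * pi * snd x))"

lemma continuous_on_cylinder [continuous_intros]: "continuous_on T cylinder"
  unfolding cylinder_def by (intro continuous_intros)

lemma cis_quarter_turn: "cis (2 * pi * (t + 1/4)) = \<i> * cis (2 * pi * t)"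
  by (simp add: distrib_left cis_mult[symmetric] mult.commute)

lemma cylinder_period: "cylinder (y, t + 1) = cylinder (y, t)"
  by (simp add: cylinder_def distrib_left cis_mult[symmetric])

lemma cylinder_quarter_turn: "cylinder (y + 1/4, t + 1/4) = (y + 1/4, \<i> * cis (2 * pi * t))"
  unfolding cylinder_def fst_conv snd_conv cis_quarter_turn ..

text \<open>
  Four quarter turns in a row lead from \<open>(y, t)\<close> to \<open>(y + 1, t + 1)\<close>, and each of them changes the
  argument by the same odd multiple of \<open>\<pi>\<close>. The total is \<open>2\<pi>\<close> times an even number. Moving from \<open>y\<close>
  to \<open>y + 1\<close> above the point \<open>c\<close> consists of two half periods with the same odd multiple of \<open>\<pi>\<close>,
  which gives \<open>2\<pi>\<close> times an odd number. The rest, which is the winding along the boundary circle,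
  must be odd.
\<close>

lemma boundary_winding_odd:
  fixes f :: "real \<times> complex \<Rightarrow> complex"
  assumes f: "continuous_on UNIV f"
    and turn: "\<And>y \<zeta>. f (y + 1/4, \<i> * \<zeta>) = - f (y, \<zeta>)"
    and bdry: "\<And>y \<zeta>. cmod \<zeta> = 1 \<Longrightarrow> f (y, \<zeta>) \<noteq> 0"
    and c: "cmod c = 1" "\<And>y. f (y + 1/2, c) = - f (y, c)"
  obtains \<phi> and d :: int where "continuous_on UNIV \<phi>"
    "\<And>x. f (cylinder x) = cmod (f (cylinder x)) *\<^sub>R cis (\<phi> x)"
    "\<And>y t. \<phi> (y, t + 1) = \<phi> (y, t) + 2 * pi * d" "odd d"
proof -
  have f0: "f (cylinder x) \<noteq> 0" for x
    by (auto simp: cylinder_def intro!: bdry)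
  obtain \<phi> where \<phi>: "continuous_on UNIV \<phi>"
    "\<And>x. f (cylinder x) = cmod (f (cylinder x)) *\<^sub>R cis (\<phi> x)"
  proof (rule continuous_argument[of UNIV "\<lambda>x. f (cylinder x)"])
    show "continuous_on UNIV (\<lambda>x. f (cylinder x))"
      by (intro continuous_on_compose2[OF f] continuous_on_cylinder) auto
  qed (use f0 in \<open>auto intro: convex_imp_contractible\<close>)
  have \<phi>_comp: "continuous_on T (\<lambda>x. \<phi> (g x))" if "continuous_on T g" for g and T :: "'b::topological_space set"
    using that by (intro continuous_on_compose2[OF \<phi>(1)]) auto
  have neg: "cis (\<phi> x') = cis (pi + \<phi> x)" if "f (cylinder x') = - f (cylinder x)" for x x'
  proof (rule cis_eq_if_scaleR_eq)
    have "f (cylinder x') = cmod (f (cylinder x)) *\<^sub>R cis (pi + \<phi> x)"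
      unfolding that by (subst \<phi>(2)) (simp add: cis_mult[symmetric])
    then show "cmod (f (cylinder x')) *\<^sub>R cis (\<phi> x') = cmod (f (cylinder x)) *\<^sub>R cis (pi + \<phi> x)"
      by (metis \<phi>(2))
  qed (use f0 in auto)
  obtain d :: int where d: "\<And>x. \<phi> (fst x, snd x + 1) = \<phi> x + 2 * pi * d"
  proof (rule cis_eq_continuous_difference[of UNIV "\<lambda>x. \<phi> (fst x, snd x + 1)" \<phi>])
    show "cis (\<phi> (fst x, snd x + 1)) = cis (\<phi> x)" for x
      using \<phi>(2)[of "(fst x, snd x + 1)"] \<phi>(2)[of x] f0[of x]
      unfolding cylinder_period prod.collapse by (metis cis_eq_if_scaleR_eq zero_less_norm_iff)
  qed (auto intro!: \<phi>_comp \<phi>(1) continuous_intros)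
  obtain k :: int where k: "\<And>x. \<phi> (fst x + 1/4, snd x + 1/4) = (pi + \<phi> x) + 2 * pi * k"
  proof (rule cis_eq_continuous_difference[of UNIV "\<lambda>x. \<phi> (fst x + 1/4, snd x + 1/4)" "\<lambda>x. pi + \<phi> x"])
    show "cis (\<phi> (fst x + 1/4, snd x + 1/4)) = cis (pi + \<phi> x)" for x
      by (rule neg) (simp only: cylinder_quarter_turn turn, simp add: cylinder_def)
  qed (auto intro!: \<phi>_comp \<phi>(1) continuous_intros)
  obtain t where t: "cis (2 * pi * t) = c"
  proof -
    have "c = cis (2 * pi * (Arg c / (2 * pi)))"
      using c(1) cis_Arg[of c] by (cases "c = 0") (auto simp: sgn_div_norm)
    then show ?thesis using that by metis
  qed
  obtain m :: int where m: "\<And>y. \<phi> (y + 1/2, t) = (pi + \<phi> (y, t)) + 2 * pi * m"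
  proof (rule cis_eq_continuous_difference[of UNIV "\<lambda>y. \<phi> (y + 1/2, t)" "\<lambda>y. pi + \<phi> (y, t)"])
    show "cis (\<phi> (y + 1/2, t)) = cis (pi + \<phi> (y, t))" for y
      by (rule neg) (simp add: cylinder_def t c)
  qed (auto intro!: \<phi>_comp \<phi>(1) continuous_intros)
  have "odd d"
  proof -
    have "\<phi> (1, t + 1) = \<phi> (0, t) + 4 * pi + 8 * pi * k"
      using k[of "(0, t)"] k[of "(1/4, t + 1/4)"] k[of "(1/2, t + 1/2)"] k[of "(3/4, t + 3/4)"]
      by (simp add: add.assoc)
    moreover have "\<phi> (1, t + 1) = \<phi> (0, t) + 2 * pi + 4 * pi * m + 2 * pi * d"
      using d[of "(1, t)"] m[of 0] m[of "1/2"] by simp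
    ultimately have "(2 * pi) * real_of_int (2 + 4 * k) = (2 * pi) * real_of_int (1 + 2 * m + d)"
      by (simp add: algebra_simps)
    then have "real_of_int (2 + 4 * k) = real_of_int (1 + 2 * m + d)"
      by (simp del: of_int_add of_int_mult)
    then have "2 + 4 * k = 1 + 2 * m + d"
      unfolding of_int_eq_iff .
    then show ?thesis by presburger
  qed
  then show ?thesis
    using that[OF \<phi>] d by auto
qed

text \<open>
  Over the contractible part \<open>{0..1/4} \<times> cball 0 1\<close> the map lifts to \<open>(z, w)\<close>. On the boundary
  neither \<open>z\<close> nor \<open>w\<close> vanishes and \<open>f\<close> is a positive multiple of \<open>z * cnj w\<close>, so that \<open>d = a - b\<close>,
  where \<open>a\<close> and \<open>b\<close> are the windings of \<open>z\<close> and \<open>w\<close>; they are the same at \<open>y = 0\<close> and at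
  \<open>y = 1/4\<close>. The quarter turn takes each value of \<open>(f, h)\<close> to its antipode, hence \<open>(z, w)\<close> at
  \<open>y = 1/4\<close> is a multiple of \<open>(- cnj w, cnj z)\<close> at \<open>y = 0\<close>. The factor is a nonvanishing function on the whole disc
  and has winding \<open>0\<close>. This gives \<open>a = -b\<close> and \<open>d = 2a\<close>.

  In the language of local degrees, \<open>w\<close> vanishes at the zeros of \<open>f\<close> with \<open>h > 0\<close> and \<open>z\<close> at those with
  \<open>h < 0\<close>, and the symmetry says that both kinds contribute equally to the winding of \<open>f\<close>.
\<close>

lemma boundary_winding_even:
  fixes f :: "real \<times> complex \<Rightarrow> complex" and h :: "real \<times> complex \<Rightarrow> real" and d :: int
  assumes f: "continuous_on UNIV f" and h: "continuous_on UNIV h"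
    and unit: "\<And>x. (cmod (f x))\<^sup>2 + (h x)\<^sup>2 = 1"
    and f_turn: "\<And>y \<zeta>. f (y + 1/4, \<i> * \<zeta>) = - f (y, \<zeta>)"
    and h_turn: "\<And>y \<zeta>. h (y + 1/4, \<i> * \<zeta>) = - h (y, \<zeta>)"
    and bdry: "\<And>y \<zeta>. cmod \<zeta> = 1 \<Longrightarrow> f (y, \<zeta>) \<noteq> 0"
    and \<phi>: "continuous_on UNIV \<phi>" "\<And>x. f (cylinder x) = cmod (f (cylinder x)) *\<^sub>R cis (\<phi> x)"
    and d: "\<And>y t. \<phi> (y, t + 1) = \<phi> (y, t) + 2 * pi * d"
  shows "even d"
proof -
  have f0: "f (cylinder x) \<noteq> 0" for x
    by (auto simp: cylinder_def intro!: bdry)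
  define S :: "(real \<times> complex) set" where "S = {0..1/4} \<times> cball 0 1"
  define D :: "(real \<times> real) set" where "D = {0..1/4} \<times> UNIV"
  have D: "convex D" "connected D" "contractible D"
    by (auto simp: D_def intro!: convex_connected convex_imp_contractible convex_Times)
  have eS: "cylinder x \<in> S" if "x \<in> D" for x
    using that by (auto simp: cylinder_def S_def D_def)
  obtain z w where z: "continuous_on S z" and w: "continuous_on S w"
    and lift: "\<And>x. x \<in> S \<Longrightarrow> hopf_lift (f x) (h x) (z x) (w x)"
  proof (rule continuous_hopf_lift[of S f h])
    show "compact S" "convex S" "0 \<in> S"
      by (auto simp: S_def zero_prod_def intro!: compact_Times convex_Times)
  qed (use unit in \<open>auto intro: continuous_on_subset[OF f] continuous_on_subset[OF h]\<close>)
  have nz: "z (cylinder x) \<noteq> 0" "w (cylinder x) \<noteq> 0" "h (cylinder x) < 1" if "x \<in> D" for x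
  proof -
    have "(h (cylinder x))\<^sup>2 < 1"
      using unit[of "cylinder x"] f0[of x] zero_less_power2[of "cmod (f (cylinder x))"]
      unfolding norm_eq_zero by linarith
    then have h: "\<bar>h (cylinder x)\<bar> < 1"
      by (simp add: abs_square_less_1)
    then show "h (cylinder x) < 1" by linarith
    have "complex_of_real (1 - h (cylinder x)) \<noteq> 0" "complex_of_real (1 + h (cylinder x)) \<noteq> 0"
      unfolding of_real_eq_0_iff using h by linarith+
    then show "z (cylinder x) \<noteq> 0" "w (cylinder x) \<noteq> 0"
      using lift[OF eS[OF that]] f0[of x] by (auto simp: hopf_lift_def)
  qed
  obtain \<alpha> where \<alpha>: "continuous_on D \<alpha>"
    "\<And>x. x \<in> D \<Longrightarrow> z (cylinder x) = cmod (z (cylinder x)) *\<^sub>R cis (\<alpha> x)"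
  proof (rule continuous_argument[of D "\<lambda>x. z (cylinder x)"])
    show "continuous_on D (\<lambda>x. z (cylinder x))"
      using eS by (intro continuous_on_compose2[OF z] continuous_on_cylinder) auto
  qed (use D nz in auto)
  obtain \<beta> where \<beta>: "continuous_on D \<beta>"
    "\<And>x. x \<in> D \<Longrightarrow> w (cylinder x) = cmod (w (cylinder x)) *\<^sub>R cis (\<beta> x)"
  proof (rule continuous_argument[of D "\<lambda>x. w (cylinder x)"])
    show "continuous_on D (\<lambda>x. w (cylinder x))"
      using eS by (intro continuous_on_compose2[OF w] continuous_on_cylinder) auto
  qed (use D nz in auto)
  have next_D: "(fst x, snd x + 1) \<in> D" if "x \<in> D" for x
    using that by (auto simp: D_def)
  obtain a :: int where a: "\<And>x. x \<in> D \<Longrightarrow> \<alpha> (fst x, snd x + 1) = \<alpha> x + 2 * pi * a"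
  proof (rule cis_eq_continuous_difference[OF D(2), of "\<lambda>x. \<alpha> (fst x, snd x + 1)" \<alpha>])
    show "continuous_on D (\<lambda>x. \<alpha> (fst x, snd x + 1))"
      using next_D by (intro continuous_on_compose2[OF \<alpha>(1)] continuous_intros) auto
    show "cis (\<alpha> (fst x, snd x + 1)) = cis (\<alpha> x)" if "x \<in> D" for x
      using \<alpha>(2)[OF next_D[OF that]] \<alpha>(2)[OF that] nz(1)[OF that]
      unfolding cylinder_period prod.collapse by (metis cis_eq_if_scaleR_eq zero_less_norm_iff)
  qed (use \<alpha> in auto)
  obtain b :: int where b: "\<And>x. x \<in> D \<Longrightarrow> \<beta> (fst x, snd x + 1) = \<beta> x + 2 * pi * b"
  proof (rule cis_eq_continuous_difference[OF D(2), of "\<lambda>x. \<beta> (fst x, snd x + 1)" \<beta>])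
    show "continuous_on D (\<lambda>x. \<beta> (fst x, snd x + 1))"
      using next_D by (intro continuous_on_compose2[OF \<beta>(1)] continuous_intros) auto
    show "cis (\<beta> (fst x, snd x + 1)) = cis (\<beta> x)" if "x \<in> D" for x
      using \<beta>(2)[OF next_D[OF that]] \<beta>(2)[OF that] nz(2)[OF that]
      unfolding cylinder_period prod.collapse by (metis cis_eq_if_scaleR_eq zero_less_norm_iff)
  qed (use \<beta> in auto)

  have "d = a - b"
  proof -
    obtain n :: int where n: "\<And>x. x \<in> D \<Longrightarrow> \<phi> x = (\<alpha> x - \<beta> x) + 2 * pi * n"
    proof (rule cis_eq_continuous_difference[OF D(2), of \<phi> "\<lambda>x. \<alpha> x - \<beta> x"])
      show "cis (\<phi> x) = cis (\<alpha> x - \<beta> x)" if x: "x \<in> D" for x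
      proof -
        let ?f = "f (cylinder x)" and ?z = "z (cylinder x)" and ?w = "w (cylinder x)"
        have "?f * ?w = of_real (1 - h (cylinder x)) * ?z"
          using lift[OF eS[OF x]] by (simp add: hopf_lift_def)
        then have "(of_real (cmod ?f) * cis (\<phi> x)) * (of_real (cmod ?w) * cis (\<beta> x))
            = of_real (1 - h (cylinder x)) * (of_real (cmod ?z) * cis (\<alpha> x))"
          using \<alpha>(2)[OF x] \<beta>(2)[OF x] \<phi>(2)[of x] unfolding scaleR_conv_of_real by metis
        then have "(cmod ?f * cmod ?w) *\<^sub>R cis (\<phi> x + \<beta> x)
            = ((1 - h (cylinder x)) * cmod ?z) *\<^sub>R cis (\<alpha> x)"
          unfolding scaleR_conv_of_real cis_mult[symmetric] of_real_mult by (simp only: mult_ac)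
        then have "cis (\<phi> x + \<beta> x) = cis (\<alpha> x)"
          by (rule cis_eq_if_scaleR_eq) (use f0[of x] nz[OF x] in auto)
        then show ?thesis
          by (metis add_diff_cancel_right' cis_divide)
      qed
    qed (use \<alpha> \<beta> in \<open>auto intro!: continuous_intros continuous_on_subset[OF \<phi>(1)]\<close>)
    have "(0, 0) \<in> D" "(0, 1) \<in> D"
      by (auto simp: D_def)
    then have "2 * pi * real_of_int d = 2 * pi * real_of_int (a - b)"
      using d[of 0 0] a[of "(0, 0)"] b[of "(0, 0)"] n[of "(0, 0)"] n[of "(0, 1)"]
      by (simp add: algebra_simps)
    then show ?thesis by (simp del: of_int_diff)
  qed

  moreover have "a = - b"
  proof -
    \<comment> \<open>The factor by which \<open>(z, w)\<close> at \<open>(1/4, \<i> * \<zeta>)\<close> differs from the vector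
      \<open>(- cnj w, cnj z)\<close> at \<open>(0, \<zeta>)\<close>, up to a positive real multiple.\<close>
    define l where "l \<zeta> = w (1/4, \<i> * \<zeta>) * z (0, \<zeta>) - z (1/4, \<i> * \<zeta>) * w (0, \<zeta>)" for \<zeta>
    have l: "z (1/4, \<i> * \<zeta>) * of_real ((cmod (z (0, \<zeta>)))\<^sup>2 + (cmod (w (0, \<zeta>)))\<^sup>2) = - l \<zeta> * cnj (w (0, \<zeta>))"
      "l \<zeta> \<noteq> 0" if "\<zeta> \<in> cball 0 1" for \<zeta>
    proof -
      let ?z = "z (0, \<zeta>)" and ?w = "w (0, \<zeta>)" and ?z' = "z (1/4, \<i> * \<zeta>)" and ?w' = "w (1/4, \<i> * \<zeta>)"
      have "(0, \<zeta>) \<in> S" "(1/4, \<i> * \<zeta>) \<in> S"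
        using that by (auto simp: S_def norm_mult)
      from lift[OF this(1)] lift[OF this(2)]
      have lifts: "hopf_lift (f (0, \<zeta>)) (h (0, \<zeta>)) ?z ?w"
          "hopf_lift (- f (0, \<zeta>)) (- h (0, \<zeta>)) ?z' ?w'"
        using f_turn[of 0 \<zeta>] h_turn[of 0 \<zeta>] by auto
      have N: "complex_of_real ((cmod ?z)\<^sup>2 + (cmod ?w)\<^sup>2) = ?z * cnj ?z + ?w * cnj ?w"
        unfolding of_real_add complex_norm_square ..
      have orth: "?z' * cnj ?z + ?w' * cnj ?w = 0"
        by (rule hopf_lift_antipodal_orthogonal[OF lifts])
      show 1: "?z' * of_real ((cmod ?z)\<^sup>2 + (cmod ?w)\<^sup>2) = - l \<zeta> * cnj ?w"
        unfolding N l_def using orth by algebra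
      have 2: "?w' * of_real ((cmod ?z)\<^sup>2 + (cmod ?w)\<^sup>2) = l \<zeta> * cnj ?z"
        unfolding N l_def using orth by algebra
      have "(cmod ?z)\<^sup>2 + (cmod ?w)\<^sup>2 \<noteq> 0"
        using lifts(1) by (auto simp: hopf_lift_def sum_power2_eq_zero_iff)
      then have "complex_of_real ((cmod ?z)\<^sup>2 + (cmod ?w)\<^sup>2) \<noteq> 0"
        unfolding of_real_eq_0_iff .
      moreover have "?z' \<noteq> 0 \<or> ?w' \<noteq> 0"
        using lifts(2) by (auto simp: hopf_lift_def)
      ultimately show "l \<zeta> \<noteq> 0"
        using 1 2 by force
    qed
    obtain \<eta> where \<eta>: "continuous_on (cball 0 1) \<eta>"
      "\<And>\<zeta>. \<zeta> \<in> cball 0 1 \<Longrightarrow> l \<zeta> = cmod (l \<zeta>) *\<^sub>R cis (\<eta> \<zeta>)"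
    proof (rule continuous_argument[of "cball 0 1" l])
      show "continuous_on (cball 0 1) l"
        unfolding l_def
        by (intro continuous_intros continuous_on_compose2[OF z] continuous_on_compose2[OF w])
          (auto simp: S_def norm_mult)
    qed (use l in \<open>auto intro: convex_imp_contractible\<close>)
    define q where "q t = \<eta> (cis (2 * pi * t))" for t
    obtain n :: int where n: "\<And>t. \<alpha> (1/4, t + 1/4) = (pi + q t - \<beta> (0, t)) + 2 * pi * n"
    proof (rule cis_eq_continuous_difference[of UNIV "\<lambda>t. \<alpha> (1/4, t + 1/4)" "\<lambda>t. pi + q t - \<beta> (0, t)"])
      show "continuous_on UNIV (\<lambda>t. \<alpha> (1/4, t + 1/4))"
        by (intro continuous_on_compose2[OF \<alpha>(1)] continuous_intros) (auto simp: D_def)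
      show "continuous_on UNIV (\<lambda>t. pi + q t - \<beta> (0, t))"
        unfolding q_def
        by (intro continuous_on_compose2[OF \<beta>(1)] continuous_on_compose2[OF \<eta>(1)] continuous_intros)
          (auto simp: D_def)
      fix t
      let ?\<zeta> = "cis (2 * pi * t)"
      let ?N = "(cmod (z (0, ?\<zeta>)))\<^sup>2 + (cmod (w (0, ?\<zeta>)))\<^sup>2"
      have zeta: "?\<zeta> \<in> cball 0 1" by simp
      have "(0, t) \<in> D" "(1/4, t + 1/4) \<in> D"
        by (auto simp: D_def)
      note \<alpha>' = \<alpha>(2)[OF this(2)] and \<beta>' = \<beta>(2)[OF this(1)] and nz' = nz[OF this(1)] nz[OF this(2)]
      have e: "cylinder (0, t) = (0, ?\<zeta>)" "cylinder (1/4, t + 1/4) = (1/4, \<i> * ?\<zeta>)"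
        by (simp_all only: cylinder_def fst_conv snd_conv cis_quarter_turn)
      have "cnj (w (0, ?\<zeta>)) = of_real (cmod (w (0, ?\<zeta>))) * cis (- \<beta> (0, t))"
        using arg_cong[OF \<beta>', of cnj] unfolding e scaleR_conv_of_real by (simp add: cis_cnj)
      then have "(of_real (cmod (z (1/4, \<i> * ?\<zeta>))) * cis (\<alpha> (1/4, t + 1/4))) * of_real ?N =
          - (of_real (cmod (l ?\<zeta>)) * cis (q t)) * (of_real (cmod (w (0, ?\<zeta>))) * cis (- \<beta> (0, t)))"
        using l(1)[OF zeta] \<alpha>' \<eta>(2)[OF zeta] unfolding e scaleR_conv_of_real q_def by metis
      also have "\<dots> = of_real (cmod (l ?\<zeta>) * cmod (w (0, ?\<zeta>))) * cis (pi + q t - \<beta> (0, t))"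
        by (simp add: cis_divide[symmetric] cis_mult[symmetric] divide_inverse)
      finally have "(cmod (z (1/4, \<i> * ?\<zeta>)) * ?N) *\<^sub>R cis (\<alpha> (1/4, t + 1/4)) =
          (cmod (l ?\<zeta>) * cmod (w (0, ?\<zeta>))) *\<^sub>R cis (pi + q t - \<beta> (0, t))"
        unfolding scaleR_conv_of_real of_real_mult by (simp only: mult_ac)
      then show "cis (\<alpha> (1/4, t + 1/4)) = cis (pi + q t - \<beta> (0, t))"
      proof (rule cis_eq_if_scaleR_eq)
        show "cmod (z (1/4, \<i> * ?\<zeta>)) * ?N > 0" "cmod (l ?\<zeta>) * cmod (w (0, ?\<zeta>)) > 0"
          using l(2)[OF zeta] nz' e by (auto intro!: mult_pos_pos add_pos_nonneg)
      qed
    qed auto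
    have "q 1 = q 0"
      by (simp add: q_def)
    moreover have "(0, 0) \<in> D" "(1/4, 1/4) \<in> D"
      by (auto simp: D_def)
    ultimately have "2 * pi * real_of_int a = 2 * pi * real_of_int (- b)"
      using n[of 0] n[of 1] a[of "(1/4, 1/4)"] b[of "(0, 0)"] by (simp add: algebra_simps)
    then show ?thesis by (simp del: of_int_minus)
  qed
  ultimately show ?thesis
    by simp
qed

text \<open>
  Without a common zero, \<open>(f, h)\<close> could be normalised to have values in the unit sphere, and the winding
  of \<open>f\<close> along the boundary circles would be both odd and even.
\<close>

lemma quarter_turn_equivariant_zero:
  fixes f :: "real \<times> complex \<Rightarrow> complex" and h :: "real \<times> complex \<Rightarrow> real"
  assumes f: "continuous_on UNIV f" and h: "continuous_on UNIV h"
    and f_turn: "\<And>y \<zeta>. f (y + 1/4, \<i> * \<zeta>) = - f (y, \<zeta>)"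
    and h_turn: "\<And>y \<zeta>. h (y + 1/4, \<i> * \<zeta>) = - h (y, \<zeta>)"
    and bdry: "\<And>y \<zeta>. cmod \<zeta> = 1 \<Longrightarrow> f (y, \<zeta>) \<noteq> 0"
    and c: "cmod c = 1" "\<And>y. f (y + 1/2, c) = - f (y, c)"
  obtains x where "f x = 0" "h x = 0"
proof (rule ccontr)
  assume no: "\<not> thesis"
  define r where "r x = sqrt ((cmod (f x))\<^sup>2 + (h x)\<^sup>2)" for x
  have r: "r x > 0" for x
  proof -
    have "f x \<noteq> 0 \<or> h x \<noteq> 0" using no that by blast
    then show ?thesis
      by (auto simp: r_def add_pos_nonneg add_nonneg_pos)
  qed
  then have r0: "r x \<noteq> 0" for x
    by (metis less_irrefl)
  have r_cont: "continuous_on UNIV r"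
    unfolding r_def using f h by (intro continuous_intros)
  have r_turn: "r (y + 1/4, \<i> * \<zeta>) = r (y, \<zeta>)" for y \<zeta>
    by (simp add: r_def f_turn h_turn)
  obtain \<phi> and d :: int where \<phi>: "continuous_on UNIV \<phi>"
      "\<And>x. f (cylinder x) = cmod (f (cylinder x)) *\<^sub>R cis (\<phi> x)"
      "\<And>y t. \<phi> (y, t + 1) = \<phi> (y, t) + 2 * pi * d" and "odd d"
    by (rule boundary_winding_odd[OF f f_turn bdry c]) blast+
  have "even d"
  proof (rule boundary_winding_even[of "\<lambda>x. f x /\<^sub>R r x" "\<lambda>x. h x / r x" \<phi> d])
    show "(cmod (f x /\<^sub>R r x))\<^sup>2 + (h x / r x)\<^sup>2 = 1" for x
    proof -
      have "(r x)\<^sup>2 = (cmod (f x))\<^sup>2 + (h x)\<^sup>2"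
        by (simp add: r_def)
      then have "((cmod (f x))\<^sup>2 + (h x)\<^sup>2) / (r x)\<^sup>2 = 1"
        using r0[of x] by (metis divide_self power_not_zero)
      then show ?thesis
        using r[of x] by (simp add: power_divide add_divide_distrib norm_inverse power_mult_distrib power_inverse divide_inverse algebra_simps)
    qed
    show "f (cylinder x) /\<^sub>R r (cylinder x) =
        cmod (f (cylinder x) /\<^sub>R r (cylinder x)) *\<^sub>R cis (\<phi> x)" for x
      using r[of "cylinder x"] by (subst \<phi>(2)) simp
  qed (use f h r_cont r0 \<phi> in \<open>auto simp: r_turn f_turn h_turn bdry intro!: continuous_intros\<close>)
  with \<open>odd d\<close> show False by blast
qed

section \<open>Arc length\<close>

fun polygon_length :: "(real \<Rightarrow> 'a::real_normed_vector) \<Rightarrow> real list \<Rightarrow> real" where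
  "polygon_length g (x # y # xs) = norm (g y - g x) + polygon_length g (y # xs)"
| "polygon_length g _ = 0"

lemma polygon_length_append:
  "polygon_length g (xs @ b # ys) = polygon_length g (xs @ [b]) + polygon_length g (b # ys)"
proof (induction xs)
  case (Cons x xs)
  then show ?case by (cases xs) auto
qed simp

lemma polygon_length_insert: "polygon_length g (xs @ ys) \<le> polygon_length g (xs @ b # ys)"
proof (induction xs)
  case Nil
  show ?case by (cases ys) auto
next
  case (Cons x xs)
  show ?case
  proof (cases xs)
    case Nil
    show ?thesis
      using norm_triangle_ineq[of "g b - g x" "g y - g b" for y] by (cases ys) (auto simp: Nil)
  qed (use Cons in auto)
qed

lemma polygon_length_map: "polygon_length g (map \<phi> xs) = polygon_length (\<lambda>x. g (\<phi> x)) xs"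
  by (induction g xs rule: polygon_length.induct) auto

lemma polygon_length_cong:
  "(\<And>x. x \<in> set xs \<Longrightarrow> g x = h x) \<Longrightarrow> polygon_length g xs = polygon_length h xs"
  by (induction g xs rule: polygon_length.induct) auto

lemma polygon_length_remdups_adj: "polygon_length g (remdups_adj xs) = polygon_length g xs"
proof (induction xs rule: remdups_adj.induct)
  case (3 x y xs)
  then show ?case
    by (cases "remdups_adj (y # xs)") (auto split: if_splits dest: arg_cong[of _ _ hd])
qed auto

lemma polygon_length_conv_sum:
  "polygon_length g xs = (\<Sum>j = 1..<length xs. norm (g (xs ! j) - g (xs ! (j - 1))))"
proof (induction g xs rule: polygon_length.induct)
  case (1 g x y xs)
  have "(\<Sum>j = 1..<length (x # y # xs). norm (g ((x # y # xs) ! j) - g ((x # y # xs) ! (j - 1))))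
      = norm (g y - g x) + (\<Sum>j = 2..<Suc (length (y # xs)). norm (g ((x # y # xs) ! j) - g ((x # y # xs) ! (j - 1))))"
    by (subst sum.atLeast_Suc_lessThan) (auto simp: numeral_2_eq_2)
  also have "(\<Sum>j = 2..<Suc (length (y # xs)). norm (g ((x # y # xs) ! j) - g ((x # y # xs) ! (j - 1))))
      = (\<Sum>j = 1..<length (y # xs). norm (g ((y # xs) ! j) - g ((y # xs) ! (j - 1))))"
    unfolding numeral_2_eq_2 One_nat_def sum.shift_bounds_Suc_ivl
    by (intro sum.cong) (auto simp: nth_Cons')
  finally show ?case
    using 1 by simp
qed auto

text \<open>
  Lists with repetitions are admitted as polygons. They make it possible to insert points, to map a
  polygon by a weakly monotone function, and to treat subpaths that consist of a single point.
\<close>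

definition polygon_lengths :: "(real \<Rightarrow> 'a::real_normed_vector) \<Rightarrow> real \<Rightarrow> real \<Rightarrow> real set" where
  "polygon_lengths g a b = polygon_length g ` {xs. sorted xs \<and> set xs \<subseteq> {a..b}}"

definition arc_length :: "(real \<Rightarrow> 'a::real_normed_vector) \<Rightarrow> real \<Rightarrow> real \<Rightarrow> real" where
  "arc_length g a b = Sup (polygon_lengths g a b)"

lemma polygon_lengthsI:
  "sorted xs \<Longrightarrow> set xs \<subseteq> {a..b} \<Longrightarrow> polygon_length g xs \<in> polygon_lengths g a b"
  by (auto simp: polygon_lengths_def)

lemma polygon_lengths_nonempty: "polygon_lengths g a b \<noteq> {}"
  using polygon_lengthsI[of "[]" a b g] by auto

lemma polygon_length_le_arc_length:
  assumes "bdd_above (polygon_lengths g a b)" "sorted xs" "set xs \<subseteq> {a..b}"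
  shows "polygon_length g xs \<le> arc_length g a b"
  unfolding arc_length_def by (intro cSup_upper polygon_lengthsI assms)

lemma arc_length_least:
  assumes "\<And>xs. sorted xs \<Longrightarrow> set xs \<subseteq> {a..b} \<Longrightarrow> polygon_length g xs \<le> B"
  shows "arc_length g a b \<le> B"
  unfolding arc_length_def using assms
  by (intro cSup_least polygon_lengths_nonempty) (auto simp: polygon_lengths_def)

lemma bdd_above_polygon_lengths_subset:
  assumes "bdd_above (polygon_lengths g a b)" "a \<le> c" "d \<le> b"
  shows "bdd_above (polygon_lengths g c d)"
proof (rule bdd_above_mono[OF assms(1)])
  have "{c..d} \<subseteq> {a..b}"
    using assms(2,3) by auto
  then show "polygon_lengths g c d \<subseteq> polygon_lengths g a b"
    unfolding polygon_lengths_def by (intro image_mono) blast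
qed

lemma inscribed_polygon_lengths_eq: "inscribed_polygon_lengths g = polygon_lengths g 0 1"
proof (intro set_eqI iffI)
  fix s assume "s \<in> inscribed_polygon_lengths g"
  then obtain n :: nat and x :: "nat \<Rightarrow> real" where
    s: "s = (\<Sum>j = 1..<n. norm (g (x (Suc j)) - g (x j)))"
    and x: "\<And>j. j \<in> {1..n} \<Longrightarrow> x j \<in> {0..1}" "\<And>j. j \<in> {1..<n} \<Longrightarrow> x j < x (Suc j)"
    unfolding inscribed_polygon_lengths_def by blast
  define xs where "xs = map x [1..<Suc n]"
  have nth: "xs ! i = x (Suc i)" if "i < n" for i
    using that by (simp add: xs_def del: upt_Suc)
  have len: "length xs = n"
    by (simp add: xs_def)
  have "sorted xs"
    unfolding sorted_iff_nth_Suc len using x(2)[of "Suc i" for i] nth by (auto intro: less_imp_le)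
  moreover have "set xs \<subseteq> {0..1}"
    using x(1) by (auto simp: xs_def)
  moreover have "polygon_length g xs = s"
    unfolding polygon_length_conv_sum s len by (intro sum.cong) (auto simp: nth)
  ultimately show "s \<in> polygon_lengths g 0 1"
    using polygon_lengthsI by blast
next
  fix s assume "s \<in> polygon_lengths g 0 1"
  then obtain xs where xs: "sorted xs" "set xs \<subseteq> {0..1}" "s = polygon_length g xs"
    by (auto simp: polygon_lengths_def)
  define ys where "ys = remdups_adj xs"
  have ys: "sorted ys" "set ys \<subseteq> {0..1}" "s = polygon_length g ys" "distinct_adj ys"
    using xs by (auto simp: ys_def polygon_length_remdups_adj sorted_remdups_adj)
  have "s = (\<Sum>j = 1..<length ys. norm (g (ys ! (Suc j - 1)) - g (ys ! (j - 1))))"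
    by (simp add: ys(3) polygon_length_conv_sum)
  moreover have "ys ! (j - 1) \<in> {0..1}" if "j \<in> {1..length ys}" for j
    using that by (intro subsetD[OF ys(2)] nth_mem) auto
  moreover have "ys ! (j - 1) < ys ! (Suc j - 1)" if "j \<in> {1..<length ys}" for j
  proof -
    have "ys ! (j - 1) \<le> ys ! j"
      using that ys(1) by (intro sorted_nth_mono) auto
    moreover have "ys ! (j - 1) \<noteq> ys ! j"
      using that ys(4) unfolding distinct_adj_conv_nth by (metis Suc_diff_1 Suc_diff_le atLeastLessThan_iff diff_Suc_1 less_diff_conv Suc_eq_plus1 Suc_le_eq)
    ultimately show ?thesis by simp
  qed
  ultimately show "s \<in> inscribed_polygon_lengths g"
    unfolding inscribed_polygon_lengths_def
    by (intro CollectI exI[of _ "length ys"] exI[of _ "\<lambda>j. ys ! (j - 1)"]) auto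
qed

lemma curve_length_eq_arc_length: "curve_length g = arc_length g 0 1"
  by (simp add: curve_length_def arc_length_def inscribed_polygon_lengths_eq)

lemma rectifiable_iff_bdd_above: "rectifiable g \<longleftrightarrow> bdd_above (polygon_lengths g 0 1)"
proof
  assume "rectifiable g"
  then show "bdd_above (polygon_lengths g 0 1)"
    unfolding rectifiable_def inscribed_polygon_lengths_eq by (meson bdd_aboveI less_imp_le)
next
  assume "bdd_above (polygon_lengths g 0 1)"
  then obtain B where "\<forall>s\<in>polygon_lengths g 0 1. s \<le> B"
    by (auto simp: bdd_above_def)
  then show "rectifiable g"
    unfolding rectifiable_def inscribed_polygon_lengths_eq
    by (intro exI[of _ "max B 0 + 1"]) (auto simp: max_def intro: le_less_trans)
qed

lemma sorted_split_at:
  fixes b :: real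
  assumes "sorted xs"
  obtains ys zs where "xs = ys @ zs" "set ys \<subseteq> {..b}" "set zs \<subseteq> {b..}"
  using assms
proof (induction xs arbitrary: thesis)
  case (Cons x xs)
  then obtain ys zs where *: "xs = ys @ zs" "set ys \<subseteq> {..b}" "set zs \<subseteq> {b..}"
    by (metis sorted_simps(2))
  show ?case
  proof (cases "x \<le> b")
    case True
    then show ?thesis
      using * Cons.prems(1)[of "x # ys" zs] by auto
  next
    case False
    then show ?thesis
      using Cons.prems(1)[of "[]" "x # xs"] Cons.prems(2) by force
  qed
qed simp

lemma arc_length_add:
  assumes "a \<le> b" "b \<le> c"
    and 1: "bdd_above (polygon_lengths g a b)" and 2: "bdd_above (polygon_lengths g b c)"
  shows "bdd_above (polygon_lengths g a c)"
    and "arc_length g a c = arc_length g a b + arc_length g b c"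
proof -
  have le: "polygon_length g xs \<le> arc_length g a b + arc_length g b c"
    if xs: "sorted xs" "set xs \<subseteq> {a..c}" for xs
  proof -
    obtain ys zs where s: "xs = ys @ zs" "set ys \<subseteq> {..b}" "set zs \<subseteq> {b..}"
      using sorted_split_at[OF xs(1)] by blast
    have "polygon_length g xs \<le> polygon_length g (ys @ [b]) + polygon_length g (b # zs)"
      unfolding s(1) polygon_length_append[symmetric] by (rule polygon_length_insert)
    also have "\<dots> \<le> arc_length g a b + arc_length g b c"
      using xs s assms by (intro add_mono polygon_length_le_arc_length) (fastforce simp: sorted_append subset_iff)+
    finally show ?thesis .
  qed
  show bdd: "bdd_above (polygon_lengths g a c)"
    by (rule bdd_aboveI[of _ "arc_length g a b + arc_length g b c"])
      (auto simp: polygon_lengths_def le)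
  show "arc_length g a c = arc_length g a b + arc_length g b c"
  proof (rule antisym)
    show "arc_length g a c \<le> arc_length g a b + arc_length g b c"
      by (rule arc_length_least) (rule le)
    have "polygon_length g ys + polygon_length g zs \<le> arc_length g a c"
      if ys: "sorted ys" "set ys \<subseteq> {a..b}" and zs: "sorted zs" "set zs \<subseteq> {b..c}" for ys zs
    proof -
      have "polygon_length g ys + polygon_length g zs
          \<le> polygon_length g (ys @ [b]) + polygon_length g (b # zs)"
        using polygon_length_insert[of g ys "[]" b] polygon_length_insert[of g "[]" zs b] by simp
      also have "\<dots> = polygon_length g (ys @ b # zs)"
        by (simp add: polygon_length_append[of g ys b zs])
      also have "\<dots> \<le> arc_length g a c"
        using ys zs assms(1,2) by (intro polygon_length_le_arc_length bdd) (force simp: sorted_append)+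
      finally show ?thesis .
    qed
    then have "polygon_length g zs \<le> arc_length g a c - polygon_length g ys"
      if "sorted ys" "set ys \<subseteq> {a..b}" "sorted zs" "set zs \<subseteq> {b..c}" for ys zs
      using that by (simp add: le_diff_eq add.commute[of "polygon_length g zs"])
    then have "arc_length g b c \<le> arc_length g a c - polygon_length g ys"
      if "sorted ys" "set ys \<subseteq> {a..b}" for ys
      using that by (intro arc_length_least)
    then have "arc_length g a b \<le> arc_length g a c - arc_length g b c"
      by (intro arc_length_least) (simp add: algebra_simps)
    then show "arc_length g a b + arc_length g b c \<le> arc_length g a c"
      by simp
  qed
qed

lemma polygon_lengths_affine:
  assumes "0 \<le> m" "a \<le> b"
  shows "polygon_lengths (\<lambda>x. g (m * x + k)) a b = polygon_lengths g (m * a + k) (m * b + k)"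
proof (intro set_eqI iffI)
  fix s assume "s \<in> polygon_lengths (\<lambda>x. g (m * x + k)) a b"
  then obtain xs where xs: "sorted xs" "set xs \<subseteq> {a..b}" "s = polygon_length (\<lambda>x. g (m * x + k)) xs"
    by (auto simp: polygon_lengths_def)
  have "polygon_length g (map (\<lambda>x. m * x + k) xs) \<in> polygon_lengths g (m * a + k) (m * b + k)"
    using xs(1,2) assms
    by (intro polygon_lengthsI) (auto simp: sorted_map mult_left_mono intro: sorted_wrt_mono_rel[of xs "(\<le>)"])
  then show "s \<in> polygon_lengths g (m * a + k) (m * b + k)"
    by (simp add: xs(3) polygon_length_map)
next
  fix s assume "s \<in> polygon_lengths g (m * a + k) (m * b + k)"
  then obtain ys where ys: "sorted ys" "set ys \<subseteq> {m * a + k..m * b + k}" "s = polygon_length g ys"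
    by (auto simp: polygon_lengths_def)
  show "s \<in> polygon_lengths (\<lambda>x. g (m * x + k)) a b"
  proof -
    define xs where "xs = map (\<lambda>y. if m = 0 then a else (y - k) / m) ys"
    have "map (\<lambda>x. m * x + k) xs = ys"
      using ys(2) by (cases "m = 0") (fastforce simp: xs_def comp_def intro!: map_idI)+
    then have "s = polygon_length (\<lambda>x. g (m * x + k)) xs"
      by (metis ys(3) polygon_length_map)
    moreover have "sorted xs"
      using ys(1) assms(1) unfolding xs_def sorted_map
      by (auto simp: divide_right_mono intro: sorted_wrt_mono_rel[of ys "(\<le>)"])
    moreover have "set xs \<subseteq> {a..b}"
    proof (cases "m = 0")
      case False
      then show ?thesis
        using ys(2) assms(1) by (force simp: xs_def field_simps)
    qed (use assms(2) in \<open>auto simp: xs_def\<close>)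
    ultimately show ?thesis
      using polygon_lengthsI by blast
  qed
qed

lemma polygon_lengths_cong:
  "(\<And>x. x \<in> {a..b} \<Longrightarrow> g x = h x) \<Longrightarrow> polygon_lengths g a b = polygon_lengths h a b"
  unfolding polygon_lengths_def by (intro image_cong refl polygon_length_cong) auto

lemma polygon_lengths_subpath:
  assumes "a \<le> b"
  shows "polygon_lengths (subpath a b g) 0 1 = polygon_lengths g a b"
  using polygon_lengths_affine[of "b - a" 0 1 g a] assms by (simp add: subpath_def)

lemma curve_length_subpath: "a \<le> b \<Longrightarrow> curve_length (subpath a b g) = arc_length g a b"
  by (simp add: curve_length_eq_arc_length arc_length_def polygon_lengths_subpath)

lemma curve_length_joinpaths:
  assumes "rectifiable g" "rectifiable h" "pathfinish g = pathstart h"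
  shows "curve_length (g +++ h) = curve_length g + curve_length h"
proof -
  have "polygon_lengths (g +++ h) 0 (1/2) = polygon_lengths (\<lambda>x. g (2 * x + 0)) 0 (1/2)"
    by (rule polygon_lengths_cong) (simp add: joinpaths_def)
  then have 1: "polygon_lengths (g +++ h) 0 (1/2) = polygon_lengths g 0 1"
    using polygon_lengths_affine[of 2 0 "1/2" g 0] by simp
  have "polygon_lengths (g +++ h) (1/2) 1 = polygon_lengths (\<lambda>x. h (2 * x + - 1)) (1/2) 1"
  proof (rule polygon_lengths_cong)
    fix x :: real assume "x \<in> {1/2..1}"
    then show "(g +++ h) x = h (2 * x + - 1)"
    proof (cases "x = 1/2")
      case True
      show ?thesis
        unfolding True using assms(3) by (simp add: joinpaths_def pathfinish_def pathstart_def)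
    qed (auto simp: joinpaths_def)
  qed
  then have 2: "polygon_lengths (g +++ h) (1/2) 1 = polygon_lengths h 0 1"
    using polygon_lengths_affine[of 2 "1/2" 1 h "-1"] by simp
  show ?thesis
    using arc_length_add(2)[of 0 "1/2" 1 "g +++ h"] assms(1,2)
    unfolding rectifiable_iff_bdd_above curve_length_eq_arc_length 1 2
    by (simp add: arc_length_def 1 2)
qed

lemma continuous_on_polygon_length:
  assumes "\<And>x. x \<in> set xs \<Longrightarrow> continuous_on S (\<lambda>s. g (c s x))"
  shows "continuous_on S (\<lambda>s. polygon_length g (map (c s) xs))"
  using assms
proof (induction xs rule: induct_list012)
  case (3 x y xs)
  then show ?case
    by (auto intro!: continuous_intros)
qed auto

lemma dist_le_arc_length:
  assumes "bdd_above (polygon_lengths g a b)" "a \<le> b"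
  shows "norm (g b - g a) \<le> arc_length g a b"
  using polygon_length_le_arc_length[OF assms(1), of "[a, b]"] assms(2) by simp

text \<open>
  The length of a fixed polygon depends continuously on \<open>s\<close> if its vertices beyond \<open>s\<close> are moved to \<open>s\<close>.
  The arc length up to \<open>s\<close>, and likewise from \<open>s\<close>, is a supremum of such functions.
\<close>

lemma arc_length_lower_semicontinuous:
  assumes g: "continuous_on {a..b} g" and bdd: "bdd_above (polygon_lengths g a b)"
    and t: "t \<in> {a..b}" and "\<epsilon> > 0"
  shows "\<forall>\<^sub>F s in at t within {a..b}. arc_length g a t - \<epsilon> < arc_length g a s"
    and "\<forall>\<^sub>F s in at t within {a..b}. arc_length g t b - \<epsilon> < arc_length g s b"
proof -
  have bdd': "bdd_above (polygon_lengths g a s)" "bdd_above (polygon_lengths g s b)" if "s \<in> {a..b}" for s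
    using that by (auto intro: bdd_above_polygon_lengths_subset[OF bdd])
  have in_S: "\<forall>\<^sub>F s in at t within {a..b}. s \<in> {a..b}"
    by (auto simp: eventually_at_filter)
  obtain xs where xs: "sorted xs" "set xs \<subseteq> {a..t}" "arc_length g a t - \<epsilon> < polygon_length g xs"
    using less_cSupD[OF polygon_lengths_nonempty, of "arc_length g a t - \<epsilon>" g a t] \<open>\<epsilon> > 0\<close>
    by (auto simp: polygon_lengths_def arc_length_def)
  have "continuous_on {a..b} (\<lambda>s. polygon_length g (map (min s) xs))"
    using subsetD[OF xs(2)] t
    by (intro continuous_on_polygon_length continuous_on_compose2[OF g] continuous_intros)
      (fastforce simp: min_def max_def)+
  then have "((\<lambda>s. polygon_length g (map (min s) xs)) \<longlongrightarrow> polygon_length g (map (min t) xs)) (at t within {a..b})"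
    using t by (simp add: continuous_on_def)
  moreover have "map (min t) xs = xs"
    using xs(2) by (auto intro!: map_idI)
  ultimately have "\<forall>\<^sub>F s in at t within {a..b}. arc_length g a t - \<epsilon> < polygon_length g (map (min s) xs)"
    using xs(3) by (intro order_tendstoD) auto
  then show "\<forall>\<^sub>F s in at t within {a..b}. arc_length g a t - \<epsilon> < arc_length g a s"
    using in_S
  proof eventually_elim
    case (elim s)
    have "polygon_length g (map (min s) xs) \<le> arc_length g a s"
      using xs(1,2) elim(2) bdd'(1)[of s]
      by (intro polygon_length_le_arc_length)
        (auto simp: sorted_map intro: sorted_wrt_mono_rel[of xs "(\<le>)"])
    with elim show ?case by simp
  qed
  obtain xs where xs: "sorted xs" "set xs \<subseteq> {t..b}" "arc_length g t b - \<epsilon> < polygon_length g xs"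
    using less_cSupD[OF polygon_lengths_nonempty, of "arc_length g t b - \<epsilon>" g t b] \<open>\<epsilon> > 0\<close>
    by (auto simp: polygon_lengths_def arc_length_def)
  have "continuous_on {a..b} (\<lambda>s. polygon_length g (map (max s) xs))"
    using subsetD[OF xs(2)] t
    by (intro continuous_on_polygon_length continuous_on_compose2[OF g] continuous_intros)
      (fastforce simp: min_def max_def)+
  then have "((\<lambda>s. polygon_length g (map (max s) xs)) \<longlongrightarrow> polygon_length g (map (max t) xs)) (at t within {a..b})"
    using t by (simp add: continuous_on_def)
  moreover have "map (max t) xs = xs"
    using xs(2) by (auto intro!: map_idI)
  ultimately have "\<forall>\<^sub>F s in at t within {a..b}. arc_length g t b - \<epsilon> < polygon_length g (map (max s) xs)"
    using xs(3) by (intro order_tendstoD) auto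
  then show "\<forall>\<^sub>F s in at t within {a..b}. arc_length g t b - \<epsilon> < arc_length g s b"
    using in_S
  proof eventually_elim
    case (elim s)
    have "polygon_length g (map (max s) xs) \<le> arc_length g s b"
      using xs(1,2) elim(2) bdd'(2)[of s]
      by (intro polygon_length_le_arc_length)
        (auto simp: sorted_map intro: sorted_wrt_mono_rel[of xs "(\<le>)"])
    with elim show ?case by simp
  qed
qed

text \<open>
  The arc lengths up to \<open>s\<close> and from \<open>s\<close> are lower semicontinuous with constant sum, so both
  are continuous.
\<close>

lemma continuous_on_arc_length:
  assumes g: "continuous_on {a..b} g" and bdd: "bdd_above (polygon_lengths g a b)"
  shows "continuous_on {a..b} (arc_length g a)"
  unfolding continuous_on_def
proof (intro ballI tendstoI)
  fix t \<epsilon> :: real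
  assume t: "t \<in> {a..b}" and "\<epsilon> > 0"
  have split: "arc_length g a b = arc_length g a s + arc_length g s b" if "s \<in> {a..b}" for s
    using that by (intro arc_length_add(2)) (auto intro: bdd_above_polygon_lengths_subset[OF bdd])
  have in_S: "\<forall>\<^sub>F s in at t within {a..b}. s \<in> {a..b}"
    by (auto simp: eventually_at_filter)
  show "\<forall>\<^sub>F s in at t within {a..b}. dist (arc_length g a s) (arc_length g a t) < \<epsilon>"
    using arc_length_lower_semicontinuous[OF g bdd t \<open>\<epsilon> > 0\<close>] in_S
  proof eventually_elim
    case (elim s)
    then show ?case
      using split[OF t] split[OF elim(3)] by (simp add: dist_real_def abs_less_iff)
  qed
qed

lemma continuous_periodic_extension:
  fixes g :: "real \<Rightarrow> 'a::topological_space"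
  assumes g: "continuous_on {0..1} g" and eq: "g 0 = g 1"
  shows "continuous_on UNIV (\<lambda>x. g (frac x))"
proof -
  have "continuous_on ({-1..0} \<union> {0..1}) (\<lambda>x. if x \<le> 0 then g (x + 1) else g x)"
    by (rule continuous_on_If) (auto intro!: continuous_on_compose2[OF g] continuous_intros simp: eq)
  then have glued: "continuous_on {-1..1} (\<lambda>x. if x \<le> 0 then g (x + 1) else g x)"
    by (simp add: ivl_disj_un_two_touch)
  have "(if x \<le> 0 then g (x + 1) else g x) = g (frac x)" if x: "x \<in> {-1..1}" for x
  proof -
    consider "x = -1" | "-1 < x" "x < 0" | "x = 0" | "0 < x" "x < 1" | "x = 1"
      using x by fastforce
    then show ?thesis
    proof cases
      case 2
      then have "frac x = x + 1"
        using frac_unique_iff[of x "x + 1"] by simp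
      with 2 show ?thesis by simp
    next
      case 4
      then show ?thesis by (simp add: frac_eq)
    qed (simp_all add: eq frac_def)
  qed
  then have "continuous_on {-1..1} (\<lambda>x. g (frac x))"
    by (rule continuous_on_eq[OF glued])
  then have "continuous_on {-1<..<1} (\<lambda>x. g (frac x))"
    by (rule continuous_on_subset) auto
  then have core: "isCont (\<lambda>x. g (frac x)) x" if "-1 < x" "x < 1" for x
    using that by (simp add: continuous_on_eq_continuous_at)
  have "isCont (\<lambda>x. g (frac x)) x" for x
  proof -
    have "isCont (\<lambda>y. g (frac (y - of_int \<lfloor>x\<rfloor>))) x"
    proof (rule isCont_o2[of _ "\<lambda>y. y - of_int \<lfloor>x\<rfloor>" "\<lambda>y. g (frac y)"])
      show "isCont (\<lambda>y. g (frac y)) (x - of_int \<lfloor>x\<rfloor>)"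
        by (rule core) linarith+
    qed auto
    moreover have "frac (y - of_int \<lfloor>x\<rfloor>) = frac y" for y :: real
      by (simp add: frac_def)
    ultimately show ?thesis by simp
  qed
  then show ?thesis
    by (simp add: continuous_on_eq_continuous_at)
qed

text \<open>
  As a simple path is not constant on any interval, its arc length is a strictly increasing
  continuous function; \<open>\<tau>\<close> is the inverse of the arc length divided by its total.
\<close>

lemma arc_length_parametrization:
  fixes \<gamma> :: "real \<Rightarrow> 'a::real_normed_vector"
  assumes simple: "simple_path \<gamma>" and rect: "rectifiable \<gamma>"
  obtains L \<tau> where "L > 0" "continuous_on {0..1} \<tau>" "\<tau> 0 = 0" "\<tau> 1 = 1"
    "strict_mono_on {0..1} \<tau>" "\<And>x. x \<in> {0..1} \<Longrightarrow> arc_length \<gamma> 0 (\<tau> x) = L * x"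
proof -
  have bdd: "bdd_above (polygon_lengths \<gamma> 0 1)"
    using rect by (simp add: rectifiable_iff_bdd_above)
  have bdd': "bdd_above (polygon_lengths \<gamma> s t)" if "0 \<le> s" "t \<le> 1" for s t
    by (rule bdd_above_polygon_lengths_subset[OF bdd that])
  have \<gamma>: "continuous_on {0..1} \<gamma>"
    using simple by (simp add: simple_path_def path_def)
  let ?V = "arc_length \<gamma> 0"
  have V_less: "?V s < ?V t" if "0 \<le> s" "s < t" "t \<le> 1" for s t
  proof -
    \<comment> \<open>The intermediate point is needed for a closed curve, where \<open>s = 0\<close> and \<open>t = 1\<close> have
      the same image.\<close>
    define m where "m = (s + t) / 2"
    have m: "s < m" "m < t"
      using that by (auto simp: m_def)
    have "\<gamma> m \<noteq> \<gamma> s"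
      using simple that m unfolding simple_path_def loop_free_def by force
    then have "0 < norm (\<gamma> m - \<gamma> s)" by simp
    also have "\<dots> \<le> arc_length \<gamma> s m"
      using that m by (intro dist_le_arc_length bdd') auto
    also have "\<dots> \<le> arc_length \<gamma> s m + norm (\<gamma> t - \<gamma> m)" by simp
    also have "\<dots> \<le> arc_length \<gamma> s m + arc_length \<gamma> m t"
      using that m by (intro add_left_mono dist_le_arc_length bdd') auto
    also have "\<dots> = arc_length \<gamma> s t"
      using that m by (intro arc_length_add(2)[symmetric] bdd') auto
    also have "\<dots> = ?V t - ?V s"
      using arc_length_add(2)[of 0 s t \<gamma>] that bdd' by simp
    finally show ?thesis by simp
  qed
  have V0: "?V 0 = 0"
    using arc_length_add(2)[of 0 0 0 \<gamma>] bdd' by simp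
  define L where "L = ?V 1"
  have "L > 0"
    using V_less[of 0 1] V0 by (simp add: L_def)
  define W where "W t = ?V t / L" for t
  have W: "continuous_on {0..1} W"
    unfolding W_def using \<open>L > 0\<close> by (intro continuous_intros continuous_on_arc_length \<gamma> bdd) auto
  have W01: "W 0 = 0" "W 1 = 1"
    using V0 \<open>L > 0\<close> by (auto simp: W_def L_def)
  have W_less: "W s < W t" if "0 \<le> s" "s < t" "t \<le> 1" for s t
    using V_less[OF that] \<open>L > 0\<close> by (simp add: W_def divide_strict_right_mono)
  have inj: "inj_on W {0..1}"
    by (rule linorder_inj_onI) (use W_less in \<open>force+\<close>)
  have img: "W ` {0..1} = {0..1}"
  proof (intro equalityI subsetI)
    fix y assume "y \<in> W ` {0..1}"
    then obtain t where t: "t \<in> {0..1}" "y = W t" by blast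
    then show "y \<in> {0..1}"
      using W_less[of 0 t] W_less[of t 1] W01 by (cases "t = 0"; cases "t = 1") auto
  next
    fix y :: real assume "y \<in> {0..1}"
    then show "y \<in> W ` {0..1}"
      using IVT'[of W 0 y 1] W W01 by auto
  qed
  define \<tau> where "\<tau> = the_inv_into {0..1} W"
  have \<tau>W: "\<tau> (W t) = t" if "t \<in> {0..1}" for t
    unfolding \<tau>_def by (rule the_inv_into_f_f[OF inj that])
  have W\<tau>: "W (\<tau> x) = x" "\<tau> x \<in> {0..1}" if "x \<in> {0..1}" for x
    using f_the_inv_into_f[OF inj, of x] the_inv_into_into[OF inj, of x "{0..1}"] that img
    by (auto simp: \<tau>_def)
  show ?thesis
  proof
    show "L > 0" by fact
    show "continuous_on {0..1} \<tau>"
      using continuous_on_inv[OF W, of \<tau>] \<tau>W img by auto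
    show "\<tau> 0 = 0" "\<tau> 1 = 1"
      using \<tau>W[of 0] \<tau>W[of 1] W01 by auto
    show "strict_mono_on {0..1} \<tau>"
    proof (rule strict_mono_onI)
      fix x y :: real assume xy: "x \<in> {0..1}" "y \<in> {0..1}" "x < y"
      show "\<tau> x < \<tau> y"
      proof (rule ccontr)
        assume "\<not> \<tau> x < \<tau> y"
        then have "W (\<tau> y) \<le> W (\<tau> x)"
          using W_less[of "\<tau> y" "\<tau> x"] W\<tau>(2)[OF xy(1)] W\<tau>(2)[OF xy(2)]
          by (cases "\<tau> y = \<tau> x") auto
        then show False
          using W\<tau>(1) xy by simp
      qed
    qed
    show "?V (\<tau> x) = L * x" if "x \<in> {0..1}" for x
      using W\<tau>(1)[OF that] \<open>L > 0\<close> by (simp add: W_def field_simps)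
  qed
qed

section \<open>Inscribed rectangles\<close>

lemma Re_or_Im_ge_quarter:
  fixes \<zeta> :: complex
  assumes "cmod \<zeta> = 1"
  shows "1/4 \<le> \<bar>Re \<zeta>\<bar> \<or> 1/4 \<le> \<bar>Im \<zeta>\<bar>"
  using cmod_le[of \<zeta>] assms by linarith

text \<open>
  Four points in cyclic order on a circle of length \<open>1\<close> whose first and third gaps add up to \<open>1/2\<close> are
  \<open>x\<close>, \<open>x + p\<close>, \<open>x + p + q\<close>, \<open>x + q + 1/2\<close> with \<open>p, q \<in> {0..1/2}\<close>. Passing from one of these points to
  the next as the starting point replaces \<open>(x, p, q)\<close> by \<open>(x + p, q, 1/2 - p)\<close>. In terms of
  \<open>y = x + (p + q) / 2\<close> this is the shift \<open>y \<mapsto> y + 1/4\<close> together with a quarter turn of the square of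
  all \<open>(p, q)\<close>. The shift changes the sign of the difference \<open>f\<close> of the sums of opposite points and of
  the difference \<open>h\<close> of the lengths of the diagonals. On the boundary of the square two neighbours
  coincide and the other two points are opposite on the circle, so \<open>f\<close> is not zero there.
\<close>

lemma periodic_curve_inscribes_rectangle:
  fixes c :: "real \<Rightarrow> complex"
  assumes cont: "continuous_on UNIV c" and period: "\<And>x. c (x + 1) = c x"
    and inj: "\<And>x. c x \<noteq> c (x + 1/2)"
  obtains x p q where "0 < p" "p < 1/2" "0 < q" "q < 1/2"
    "c x + c (x + p + q) = c (x + p) + c (x + q + 1/2)"
    "cmod (c x - c (x + p + q)) = cmod (c (x + p) - c (x + q + 1/2))"
proof -
  \<comment> \<open>Clamping both coordinates maps the unit disc onto the square with centre \<open>0\<close> and side \<open>1/2\<close>,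
    and the unit circle into the boundary of this square. Clamping commutes with multiplication by \<open>\<i>\<close>.\<close>
  define k :: "real \<Rightarrow> real" where "k r = max (- 1/4) (min (1/4) r)" for r
  define P where "P \<zeta> = 1/4 + k (Im \<zeta>)" for \<zeta>
  define Q where "Q \<zeta> = 1/4 + k (Re \<zeta>)" for \<zeta>
  have PQ_range: "0 \<le> P \<zeta>" "P \<zeta> \<le> 1/2" "0 \<le> Q \<zeta>" "Q \<zeta> \<le> 1/2" for \<zeta>
    by (auto simp: P_def Q_def k_def)
  have PQ_turn: "P (\<i> * \<zeta>) = Q \<zeta>" "Q (\<i> * \<zeta>) = 1/2 - P \<zeta>" for \<zeta>
    by (auto simp: P_def Q_def k_def min_def max_def)
  define X where "X z = fst z - (P (snd z) + Q (snd z)) / 2" for z :: "real \<times> complex"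
  define A where "A z = c (X z)" for z
  define B where "B z = c (X z + P (snd z))" for z
  define C where "C z = c (X z + P (snd z) + Q (snd z))" for z
  define D where "D z = c (X z + Q (snd z) + 1/2)" for z
  define f where "f z = A z - B z + C z - D z" for z
  define h where "h z = cmod (A z - C z) - cmod (B z - D z)" for z
  have conts: "continuous_on UNIV A" "continuous_on UNIV B" "continuous_on UNIV C" "continuous_on UNIV D"
    unfolding A_def B_def C_def D_def X_def P_def Q_def k_def
    by (auto intro!: continuous_on_compose2[OF cont] continuous_intros)
  have X_turn: "X (y + 1/4, \<i> * \<zeta>) = X (y, \<zeta>) + P \<zeta>" for y \<zeta>
    by (simp add: X_def PQ_turn field_simps)
  have turn: "A (y + 1/4, \<i> * \<zeta>) = B (y, \<zeta>)" "B (y + 1/4, \<i> * \<zeta>) = C (y, \<zeta>)"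
    "C (y + 1/4, \<i> * \<zeta>) = D (y, \<zeta>)" "D (y + 1/4, \<i> * \<zeta>) = A (y, \<zeta>)" for y \<zeta>
    using period[of "X (y, \<zeta>)"] by (simp_all add: A_def B_def C_def D_def X_turn PQ_turn algebra_simps)
  have opposite: "c u \<noteq> c v" if "v = u + 1/2" for u v
    using inj that by simp
  have bdry: "f z \<noteq> 0" if edge: "P (snd z) \<in> {0, 1/2} \<or> Q (snd z) \<in> {0, 1/2}" for z
  proof -
    consider "P (snd z) = 0" | "P (snd z) = 1/2" | "Q (snd z) = 0" | "Q (snd z) = 1/2"
      using edge by blast
    then show ?thesis
    proof cases
      case 1
      then have "A z = B z"
        by (simp add: A_def B_def)
      moreover have "C z \<noteq> D z"
        unfolding C_def D_def 1 by (rule opposite) simp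
      ultimately show ?thesis
        by (simp add: f_def)
    next
      case 2
      have "C z = D z"
        unfolding C_def D_def 2 by (simp add: add_ac)
      moreover have "A z \<noteq> B z"
        unfolding A_def B_def 2 by (rule opposite) simp
      ultimately show ?thesis
        by (simp add: f_def)
    next
      case 3
      then have "B z = C z"
        by (simp add: B_def C_def)
      moreover have "A z \<noteq> D z"
        unfolding A_def D_def 3 by (rule opposite) simp
      ultimately show ?thesis
        by (simp add: f_def)
    next
      case 4
      have "D z = A z"
        unfolding A_def D_def 4 using period[of "X z"] by (simp add: add.assoc)
      moreover have "B z \<noteq> C z"
        unfolding B_def C_def 4 by (rule opposite) simp
      ultimately show ?thesis
        by (simp add: f_def)
    qed
  qed
  \<comment> \<open>At this corner three of the four points coincide.\<close>
  define e where "e = cis (pi / 4)"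
  have e: "P e = 1/2" "Q e = 1/2"
  proof -
    have "1 \<le> sqrt 2"
      by simp
    then have "1/4 \<le> sqrt 2 / 2"
      by linarith
    then have "k (sqrt 2 / 2) = 1/4"
      by (simp add: k_def)
    then show "P e = 1/2" "Q e = 1/2"
      by (simp_all add: e_def P_def Q_def cos_45 sin_45)
  qed
  obtain z where z: "f z = 0" "h z = 0"
  proof (rule quarter_turn_equivariant_zero[of f h e])
    show "continuous_on UNIV f" "continuous_on UNIV h"
      unfolding f_def h_def by (intro continuous_intros conts)+
    show "f (y, \<zeta>) \<noteq> 0" if "cmod \<zeta> = 1" for y \<zeta>
    proof (rule bdry)
      have clamped: "1/4 + k r \<in> {0, 1/2}" if "1/4 \<le> \<bar>r\<bar>" for r
      proof -
        have "k r = - 1/4 \<or> k r = 1/4"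
          using that unfolding k_def by linarith
        then show ?thesis by auto
      qed
      show "P (snd (y, \<zeta>)) \<in> {0, 1/2} \<or> Q (snd (y, \<zeta>)) \<in> {0, 1/2}"
        unfolding P_def Q_def snd_conv using Re_or_Im_ge_quarter[OF that] clamped by blast
    qed
    show "f (y + 1/2, e) = - f (y, e)" for y
      using period[of "y - 1/2"] period[of y]
      by (simp add: f_def A_def B_def C_def D_def X_def e algebra_simps)
  qed (auto simp: f_def h_def turn e_def norm_minus_commute)
  have edges: "P (snd z) \<noteq> 0" "P (snd z) \<noteq> 1/2" "Q (snd z) \<noteq> 0" "Q (snd z) \<noteq> 1/2"
    using bdry[of z] z(1) by blast+
  show ?thesis
  proof
    show "0 < P (snd z)" "P (snd z) < 1/2" "0 < Q (snd z)" "Q (snd z) < 1/2"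
      using edges PQ_range[of "snd z"] by linarith+
    show "c (X z) + c (X z + P (snd z) + Q (snd z)) = c (X z + P (snd z)) + c (X z + Q (snd z) + 1/2)"
      using z(1) unfolding f_def A_def B_def C_def D_def by algebra
    show "cmod (c (X z) - c (X z + P (snd z) + Q (snd z))) = cmod (c (X z + P (snd z)) - c (X z + Q (snd z) + 1/2))"
      using z(2) by (simp add: h_def A_def B_def C_def D_def)
  qed
qed

lemma rectangle_if_equal_diagonals:
  fixes a b c d :: "'a::real_inner"
  assumes "a + c = b + d" "norm (a - c) = norm (b - d)" "a \<noteq> b" "a \<noteq> d"
  shows "nondegenerate_rectangle a b c d"
proof -
  have c: "c = b + d - a"
    using assms(1) by (simp add: algebra_simps)
  have "(norm (a - c))\<^sup>2 = (norm (b - d))\<^sup>2"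
    by (simp add: assms(2))
  then have "(b - a) \<bullet> (d - a) = 0"
    unfolding c power2_norm_eq_inner
    by (simp add: inner_diff_left inner_diff_right inner_add_left inner_add_right inner_commute)
  then show ?thesis
    unfolding nondegenerate_rectangle_def c using assms(3,4) by (simp add: algebra_simps)
qed

text \<open>
  A cyclic configuration on the circle of length \<open>1\<close> can be read off in increasing order from \<open>0\<close>: start
  with the first of its points in \<open>{0..<1}\<close>.
\<close>

lemma rotate_gaps_into_unit_interval:
  fixes R :: "real \<Rightarrow> real \<Rightarrow> real \<Rightarrow> bool"
  assumes R: "R x p q" and pq: "0 < p" "p < 1/2" "0 < q" "q < 1/2"
    and rot: "\<And>x p q. R x p q \<Longrightarrow> R (x + p) q (1/2 - p)"
    and shift: "\<And>x p q n. R x p q \<Longrightarrow> R (x + of_int n) p q"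
  obtains x p q where "R x p q" "0 < p" "p < 1/2" "0 < q" "q < 1/2" "0 \<le> x" "x + q + 1/2 < 1"
proof -
  define y where "y = frac x"
  have y: "0 \<le> y" "y < 1"
    by (auto simp: y_def frac_lt_1)
  have 0: "R y p q"
    using shift[OF R, of "- \<lfloor>x\<rfloor>"] by (simp add: y_def frac_def)
  have 1: "R (y + p) q (1/2 - p)"
    by (rule rot[OF 0])
  have 2: "R (y + p + q) (1/2 - p) (1/2 - q)"
    by (rule rot[OF 1])
  have 3: "R (y + q + 1/2) (1/2 - q) p"
    using rot[OF 2] by (simp add: algebra_simps)
  consider "y + q + 1/2 < 1" | "y + p + q < 1" "1 \<le> y + q + 1/2"
    | "y + p < 1" "1 \<le> y + p + q" | "1 \<le> y + p"
    by linarith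
  then show ?thesis
  proof cases
    case 1
    then show ?thesis
      using that[OF 0] pq y by simp
  next
    case 2
    then show ?thesis
      using that[OF shift[OF 3, of "- 1"]] pq y by simp
  next
    case 3
    then show ?thesis
      using that[OF shift[OF 2, of "- 1"]] pq y by simp
  next
    case 4
    then show ?thesis
      using that[OF shift[OF 1, of "- 1"]] pq y by simp
  qed
qed

text \<open>
  The curve in arc length parametrization, extended periodically, satisfies the hypotheses of
  \<open>periodic_curve_inscribes_rectangle\<close>; the gaps between the four parameters are the arc lengths of the
  four pieces, as fractions of the total.
\<close>

theorem theorem3p2:
  fixes \<gamma> :: "real \<Rightarrow> real ^ 2"
  assumes "simple_path \<gamma>" and "pathfinish \<gamma> = pathstart \<gamma>" and "rectifiable \<gamma>"
  shows "\<exists>a b c d t1 t2 t3 t4.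
           nondegenerate_rectangle a b c d \<and>
           0 \<le> t1 \<and> t1 < t2 \<and> t2 < t3 \<and> t3 < t4 \<and> t4 < 1 \<and>
           {\<gamma> t1, \<gamma> t2, \<gamma> t3, \<gamma> t4} = {a, b, c, d} \<and>
           curve_length (subpath t1 t2 \<gamma>) + curve_length (subpath t3 t4 \<gamma>) =
           curve_length (subpath t2 t3 \<gamma>) + curve_length (subpath t4 1 \<gamma> +++ subpath 0 t1 \<gamma>)"
proof -
  obtain L \<tau> where \<tau>: "continuous_on {0..1} \<tau>" "\<tau> 0 = 0" "\<tau> 1 = 1"
    "strict_mono_on {0..1} \<tau>" "\<And>x. x \<in> {0..1} \<Longrightarrow> arc_length \<gamma> 0 (\<tau> x) = L * x"
    using arc_length_parametrization[OF assms(1,3)] by metis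
  have \<tau>_less: "\<tau> x < \<tau> y" if "0 \<le> x" "x < y" "y \<le> 1" for x y
    using strict_mono_onD[OF \<tau>(4), of x y] that by simp
  have \<tau>_range: "\<tau> x \<in> {0..1}" if "x \<in> {0..1}" for x
    using \<tau>_less[of 0 x] \<tau>_less[of x 1] \<tau>(2,3) that by (cases "x = 0"; cases "x = 1") auto
  have \<tau>_less_1: "\<tau> x < 1" if "0 \<le> x" "x < 1" for x
    using \<tau>_less[of x 1] \<tau>(3) that by simp
  have \<gamma>: "continuous_on {0..1} \<gamma>"
    using assms(1) by (simp add: simple_path_def path_def)
  have loop_free: "s = t \<or> s = 0 \<and> t = 1 \<or> s = 1 \<and> t = 0"
    if "s \<in> {0..1}" "t \<in> {0..1}" "\<gamma> s = \<gamma> t" for s t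
    using assms(1) that unfolding simple_path_def loop_free_def by blast
  define c where "c x = \<gamma> (\<tau> (frac x))" for x
  have c_cont: "continuous_on UNIV c"
    unfolding c_def
  proof (rule continuous_periodic_extension)
    show "continuous_on {0..1} (\<lambda>x. \<gamma> (\<tau> x))"
      using \<tau>_range by (intro continuous_on_compose2[OF \<gamma> \<tau>(1)]) auto
    show "\<gamma> (\<tau> 0) = \<gamma> (\<tau> 1)"
      using assms(2) by (simp add: \<tau>(2,3) pathfinish_def pathstart_def)
  qed
  have frac_shift: "frac (x + of_int n) = frac x" for x :: real and n
    by (simp add: frac_def)
  have c_shift: "c (x + of_int n) = c x" for x n
    by (simp add: c_def frac_shift)
  have c_inj: "c x \<noteq> c y" if "x < y" "y < x + 1" for x y
  proof
    assume eq: "c x = c y"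
    have frac01: "frac x \<in> {0..<1}" "frac y \<in> {0..<1}"
      by (auto simp: frac_lt_1)
    then have "\<tau> (frac x) \<in> {0..<1}" "\<tau> (frac y) \<in> {0..<1}"
      using \<tau>_range[of "frac x"] \<tau>_range[of "frac y"] \<tau>_less_1 by auto
    then have "\<tau> (frac x) = \<tau> (frac y)"
      using loop_free[of "\<tau> (frac x)" "\<tau> (frac y)"] eq by (auto simp: c_def)
    then have "frac x = frac y"
      using \<tau>_less[of "frac x" "frac y"] \<tau>_less[of "frac y" "frac x"] frac01
      by (cases "frac x" "frac y" rule: linorder_cases) auto
    then have "y - x = of_int (\<lfloor>y\<rfloor> - \<lfloor>x\<rfloor>)"
      by (simp add: frac_def)
    moreover have "0 < y - x" "y - x < 1"
      using that by auto
    ultimately show False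
      by (metis of_int_0_less_iff of_int_less_1_iff zless_add1_eq less_irrefl add_0 not_less_iff_gr_or_eq)
  qed

  define \<kappa> :: "real ^ 2 \<Rightarrow> complex" where "\<kappa> v = Complex (v $ 1) (v $ 2)" for v
  have \<kappa>_diff: "\<kappa> (u - v) = \<kappa> u - \<kappa> v" and \<kappa>_add: "\<kappa> (u + v) = \<kappa> u + \<kappa> v" for u v
    by (auto simp: \<kappa>_def complex_eq_iff)
  have \<kappa>_norm: "cmod (\<kappa> v) = norm v" for v
    by (simp add: \<kappa>_def cmod_def norm_vec_def L2_set_def sum_2)
  have \<kappa>_inj: "u = v" if "\<kappa> u = \<kappa> v" for u v
    using \<kappa>_norm[of "u - v"] that by (simp add: \<kappa>_diff)
  have \<kappa>_cont: "continuous_on UNIV (\<lambda>x. \<kappa> (c x))"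
    unfolding \<kappa>_def Complex_eq by (intro continuous_intros c_cont)

  define R where "R x p q \<longleftrightarrow> c x + c (x + p + q) = c (x + p) + c (x + q + 1/2) \<and>
      norm (c x - c (x + p + q)) = norm (c (x + p) - c (x + q + 1/2))" for x p q
  obtain x p q where R0: "R x p q" "0 < p" "p < 1/2" "0 < q" "q < 1/2"
  proof (rule periodic_curve_inscribes_rectangle[OF \<kappa>_cont])
    show "\<kappa> (c (x + 1)) = \<kappa> (c x)" for x
      using c_shift[of x 1] by simp
    show "\<kappa> (c x) \<noteq> \<kappa> (c (x + 1/2))" for x
      using c_inj[of x "x + 1/2"] \<kappa>_inj by auto
  qed (auto simp: R_def \<kappa>_add[symmetric] \<kappa>_diff[symmetric] \<kappa>_norm dest: \<kappa>_inj)
  obtain x p q where R: "R x p q" and pq: "0 < p" "p < 1/2" "0 < q" "q < 1/2"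
    and x: "0 \<le> x" "x + q + 1/2 < 1"
  proof (rule rotate_gaps_into_unit_interval[of R, OF R0])
    fix x p q assume R: "R x p q"
    show "R (x + p) q (1/2 - p)"
      using R c_shift[of x 1] unfolding R_def
      by (simp add: algebra_simps norm_minus_commute)
    show "R (x + of_int n) p q" for n
      using R c_shift[of x n] c_shift[of "x + p" n] c_shift[of "x + p + q" n] c_shift[of "x + q + 1/2" n]
      unfolding R_def by (simp add: algebra_simps)
  qed
  let ?t1 = "\<tau> x" and ?t2 = "\<tau> (x + p)" and ?t3 = "\<tau> (x + p + q)" and ?t4 = "\<tau> (x + q + 1/2)"
  have on_curve: "c x = \<gamma> ?t1" "c (x + p) = \<gamma> ?t2" "c (x + p + q) = \<gamma> ?t3" "c (x + q + 1/2) = \<gamma> ?t4"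
    using x pq by (simp_all add: c_def frac_eq)
  have "nondegenerate_rectangle (c x) (c (x + p)) (c (x + p + q)) (c (x + q + 1/2))"
    using R c_inj[of x "x + p"] c_inj[of x "x + q + 1/2"] pq
    by (intro rectangle_if_equal_diagonals) (auto simp: R_def)
  then have rect: "nondegenerate_rectangle (\<gamma> ?t1) (\<gamma> ?t2) (\<gamma> ?t3) (\<gamma> ?t4)"
    unfolding on_curve .
  have order: "0 \<le> ?t1" "?t1 < ?t2" "?t2 < ?t3" "?t3 < ?t4" "?t4 < 1"
    using x pq \<tau>_range[of x] by (auto intro!: \<tau>_less \<tau>_less_1)

  have bdd: "bdd_above (polygon_lengths \<gamma> s t)" if "0 \<le> s" "t \<le> 1" for s t
    using bdd_above_polygon_lengths_subset[of \<gamma> 0 1 s t] assms(3) that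
    by (simp add: rectifiable_iff_bdd_above)
  have arc: "arc_length \<gamma> (\<tau> s) (\<tau> t) = L * (t - s)" if "0 \<le> s" "s \<le> t" "t \<le> 1" for s t
  proof -
    have "\<tau> s \<le> \<tau> t"
      using \<tau>_less[of s t] that by (cases "s = t") auto
    then have "arc_length \<gamma> 0 (\<tau> t) = arc_length \<gamma> 0 (\<tau> s) + arc_length \<gamma> (\<tau> s) (\<tau> t)"
      using that \<tau>_range[of s] \<tau>_range[of t] by (intro arc_length_add(2) bdd) auto
    then show ?thesis
      using \<tau>(5)[of s] \<tau>(5)[of t] that by (simp add: right_diff_distrib)
  qed
  have sub: "curve_length (subpath (\<tau> s) (\<tau> t) \<gamma>) = L * (t - s)" if "0 \<le> s" "s < t" "t \<le> 1" for s t
    using that \<tau>_less[of s t] by (simp add: curve_length_subpath arc)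
  have "curve_length (subpath ?t4 1 \<gamma> +++ subpath 0 ?t1 \<gamma>)
      = curve_length (subpath ?t4 1 \<gamma>) + curve_length (subpath 0 ?t1 \<gamma>)"
  proof (rule curve_length_joinpaths)
    show "rectifiable (subpath ?t4 1 \<gamma>)" "rectifiable (subpath 0 ?t1 \<gamma>)"
      using order by (auto simp: rectifiable_iff_bdd_above polygon_lengths_subpath intro!: bdd)
    show "pathfinish (subpath ?t4 1 \<gamma>) = pathstart (subpath 0 ?t1 \<gamma>)"
      using assms(2) by simp (simp add: pathfinish_def pathstart_def)
  qed
  also have "\<dots> = L * (1/2 - q)"
    using order arc[of "x + q + 1/2" 1] arc[of 0 x] x pq
    by (simp add: curve_length_subpath \<tau>(2,3) algebra_simps)
  finally have last: "curve_length (subpath ?t4 1 \<gamma> +++ subpath 0 ?t1 \<gamma>) = L * (1/2 - q)" .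
  have "curve_length (subpath ?t1 ?t2 \<gamma>) + curve_length (subpath ?t3 ?t4 \<gamma>) =
      curve_length (subpath ?t2 ?t3 \<gamma>) + curve_length (subpath ?t4 1 \<gamma> +++ subpath 0 ?t1 \<gamma>)"
    unfolding last using x pq by (simp add: sub algebra_simps)
  with rect order show ?thesis
    by blast
qed

end
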